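(* Let $A$ and $B$ be discrete groups with $G=A\times B$ non-trivial, let $(\sigma_i)_{i\in\mathbb{N}}$ be a sequence of bilinear maps $\sigma_i:A\times B\to\mathbb{T}$, and set $U_i:=U_{\sigma_i}$ (the projective unitary representation of $G$ on $\ell^2(B)$ associated with $\sigma_i$). i) Assume that $\otimes_iU_i$ exists on $\bigotimes_i^{\phi}\ell^2(B)$ for some sequence $\phi=(\phi_i)$ of unit vectors in $\ell^2(B)$. Then $B$ is countable and amenable. ii) Assume that $B$ is countable and amenable, and let $(F_i)$ be a $\sigma F$-sequence for $B$ satisfying $$\sum_{i} \frac{1}{\#F_{i}} \sum_{b \in F_{i}} |1 - \sigma_{i}(a,b) | < \infty$$ for every $a\in A$. Set $\phi=(\phi_i)$ where $\phi_i:=\chi_{F_i}/(\#F_i)^{1/2}$ and $\chi_{F_i}$ is the characteristic function of $F_i$. Then $\otimes_iU_i$ exists on $\bigotimes_i^{\phi}\ell^2(B)$.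
   Context: A map $\sigma:A\times B\to\mathbb{T}$ (circle group) is bilinear if it is a group homomorphism in each variable separately. For such $\sigma$, let $V_\sigma(a)$ ($a\in A$) be the operator on $\ell^2(B)$ of multiplication by the function $b\mapsto\sigma(a,b)$, let $\lambda_B$ be the left regular representation of $B$ on $\ell^2(B)$, and set $U_\sigma(a,b):=V_\sigma(a)\lambda_B(b)$ for $(a,b)\in G=A\times B$. Then $V_\sigma(a)\lambda_B(b)=\sigma(a,b)\lambda_B(b)V_\sigma(a)$, and $U_\sigma$ is a projective unitary representation of $G$ on $\ell^2(B)$ with 2-cocycle $u_\sigma((a_1,b_1),(a_2,b_2))=\overline{\sigma(a_2,b_1)}$. A $\sigma F$-sequence for $B$ is a sequence $(F_i)$ of non-empty finite subsets of $B$ such that $\sum_i\left|1-\frac{\#(F_i\cap xF_i)}{\#F_i}\right|<\infty$ for all $x\in B$. Infinite tensor products: for a sequence of Hilbert spaces $\mathcal{H}_i$ ($i\in\mathbb{N}$) and unit vectors $\phi_i\in\mathcal{H}_i$, $\phi=(\phi_i)$, the space $\mathcal{H}^\phi=\bigotimes_i^{\phi}\mathcal{H}_i$ is the completed inductive limit of the spaces $\mathcal{H}_1\otimes\cdots\otimes\mathcal{H}_n$ under the isometries $\psi\mapsto\psi\otimes\phi_{n+1}$; it is the closed span of the elementary decomposable vectors $\psi_1\otimes\cdots\otimes\psi_k\otimes\phi_{k+1}\otimes\phi_{k+2}\otimes\cdots$. For bounded operators $T_i$ on $\mathcal{H}_i$ and a finite non-empty $J\subset\mathbb{N}$, let $\tilde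 T_J$ be the bounded operator on $\mathcal{H}^\phi$ acting as $T_i$ in the factors $i\in J$ and as the identity in the others. One says that $\otimes_iT_i$ exists on $\mathcal{H}^\phi$ if the net $(\tilde T_J)_J$ (indexed by finite non-empty subsets of $\mathbb{N}$ ordered by inclusion) converges in the strong operator topology to a bounded operator, which is then denoted $\otimes_iT_i$. For maps $U_i$ from $G$ to unitaries, "$\otimes_iU_i$ exists" means $\otimes_iU_i(x)$ exists for every $x\in G$. *)

theory Defs
  imports "HOL-Analysis.Analysis" "HOL-Algebra.Elementary_Groups"
begin

section \<open>The Hilbert spaces l2(X)\<close>

text \<open>Functions on a set \<open>X\<close> are total functions vanishing outside \<open>X\<close>, so that equality of
  functions on \<open>X\<close> is equality in HOL.\<close>

definition ell2 :: "'x set \<Rightarrow> ('x \<Rightarrow> complex) set" where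
  "ell2 X = {f. (\<forall>x. x \<notin> X \<longrightarrow> f x = 0) \<and> (\<lambda>x. (cmod (f x))\<^sup>2) summable_on X}"

definition ell2_norm :: "'x set \<Rightarrow> ('x \<Rightarrow> complex) \<Rightarrow> real" where
  "ell2_norm X f = sqrt (\<Sum>\<^sub>\<infinity>x\<in>X. (cmod (f x))\<^sup>2)"

section \<open>The infinite tensor product of copies of l2(X) along a sequence of unit vectors\<close>

text \<open>The \<open>n\<close>-fold Hilbert space tensor power of l2(X) is l2(\<open>X\<^sup>n\<close>), where \<open>X\<^sup>n\<close> consists of lists
  and the tensor product of \<open>\<psi> 0, \<dots>, \<psi> (n - 1)\<close> is the function
  \<open>xs \<mapsto> \<Prod>i<n. \<psi> i (xs ! i)\<close>. The factors are numbered from 0.\<close>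

definition tuples :: "'x set \<Rightarrow> nat \<Rightarrow> 'x list set" where
  "tuples X n = {xs. set xs \<subseteq> X \<and> length xs = n}"

definition tensor :: "'x set \<Rightarrow> nat \<Rightarrow> (nat \<Rightarrow> 'x \<Rightarrow> complex) \<Rightarrow> 'x list \<Rightarrow> complex" where
  "tensor X n \<psi> xs = (if xs \<in> tuples X n then \<Prod>i<n. \<psi> i (xs ! i) else 0)"

text \<open>For \<open>n \<le> m\<close>, the isometry of l2(\<open>X\<^sup>n\<close>) into l2(\<open>X\<^sup>m\<close>) which tensors on the right
  with \<open>\<phi> n, \<dots>, \<phi> (m - 1)\<close>.\<close>

definition tensor_embed ::
    "'x set \<Rightarrow> (nat \<Rightarrow> 'x \<Rightarrow> complex) \<Rightarrow> nat \<Rightarrow> nat \<Rightarrow> ('x list \<Rightarrow> complex) \<Rightarrow> 'x list \<Rightarrow> complex" where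
  "tensor_embed X \<phi> n m f xs =
     (if xs \<in> tuples X m then f (take n xs) * (\<Prod>i=n..<m. \<phi> i (xs ! i)) else 0)"

text \<open>An element of the inductive limit is represented by a pair \<open>(n, f)\<close> with \<open>f\<close> in
  l2(\<open>X\<^sup>n\<close>). Two pairs are combined after embedding both into the larger of the two levels; they
  represent the same element if and only if their distance \<open>ilim_dist\<close> is 0.\<close>

type_synonym 'x ilim = "nat \<times> ('x list \<Rightarrow> complex)"

definition ilim_carrier :: "'x set \<Rightarrow> 'x ilim set" where
  "ilim_carrier X = {(n, f). f \<in> ell2 (tuples X n)}"

definition ilim_add ::
    "'x set \<Rightarrow> (nat \<Rightarrow> 'x \<Rightarrow> complex) \<Rightarrow> 'x ilim \<Rightarrow> 'x ilim \<Rightarrow> 'x ilim" where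
  "ilim_add X \<phi> p q =
     (let k = max (fst p) (fst q)
      in (k, \<lambda>xs. tensor_embed X \<phi> (fst p) k (snd p) xs + tensor_embed X \<phi> (fst q) k (snd q) xs))"

definition ilim_scale :: "complex \<Rightarrow> 'x ilim \<Rightarrow> 'x ilim" where
  "ilim_scale c p = (fst p, \<lambda>xs. c * snd p xs)"

definition ilim_norm :: "'x set \<Rightarrow> 'x ilim \<Rightarrow> real" where
  "ilim_norm X p = ell2_norm (tuples X (fst p)) (snd p)"

definition ilim_dist ::
    "'x set \<Rightarrow> (nat \<Rightarrow> 'x \<Rightarrow> complex) \<Rightarrow> 'x ilim \<Rightarrow> 'x ilim \<Rightarrow> real" where
  "ilim_dist X \<phi> p q = ilim_norm X (ilim_add X \<phi> p (ilim_scale (-1) q))"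

text \<open>The completion: Cauchy sequences in the inductive limit modulo sequences whose distance
  tends to 0. This quotient also performs the identifications of the inductive limit itself.\<close>

definition ilim_Cauchy ::
    "'x set \<Rightarrow> (nat \<Rightarrow> 'x \<Rightarrow> complex) \<Rightarrow> (nat \<Rightarrow> 'x ilim) set" where
  "ilim_Cauchy X \<phi> =
     {p. (\<forall>k. p k \<in> ilim_carrier X) \<and>
         (\<forall>e>0. \<exists>N. \<forall>m\<ge>N. \<forall>n\<ge>N. ilim_dist X \<phi> (p m) (p n) < e)}"

definition itp_rel ::
    "'x set \<Rightarrow> (nat \<Rightarrow> 'x \<Rightarrow> complex) \<Rightarrow> ((nat \<Rightarrow> 'x ilim) \<times> (nat \<Rightarrow> 'x ilim)) set" where
  "itp_rel X \<phi> =
     {(p, q). p \<in> ilim_Cauchy X \<phi> \<and> q \<in> ilim_Cauchy X \<phi> \<and>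
              (\<lambda>k. ilim_dist X \<phi> (p k) (q k)) \<longlonglongrightarrow> 0}"

type_synonym 'x itp = "(nat \<Rightarrow> 'x ilim) set"

definition itp :: "'x set \<Rightarrow> (nat \<Rightarrow> 'x \<Rightarrow> complex) \<Rightarrow> 'x itp set" where
  "itp X \<phi> = ilim_Cauchy X \<phi> // itp_rel X \<phi>"

definition itp_add ::
    "'x set \<Rightarrow> (nat \<Rightarrow> 'x \<Rightarrow> complex) \<Rightarrow> 'x itp \<Rightarrow> 'x itp \<Rightarrow> 'x itp" where
  "itp_add X \<phi> u v = (\<Union>p\<in>u. \<Union>q\<in>v. itp_rel X \<phi> `` {\<lambda>k. ilim_add X \<phi> (p k) (q k)})"

definition itp_scale ::
    "'x set \<Rightarrow> (nat \<Rightarrow> 'x \<Rightarrow> complex) \<Rightarrow> complex \<Rightarrow> 'x itp \<Rightarrow> 'x itp" where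
  "itp_scale X \<phi> c u = (\<Union>p\<in>u. itp_rel X \<phi> `` {\<lambda>k. ilim_scale c (p k)})"

definition itp_norm :: "'x set \<Rightarrow> 'x itp \<Rightarrow> real" where
  "itp_norm X u = (THE r. \<exists>p\<in>u. (\<lambda>k. ilim_norm X (p k)) \<longlonglongrightarrow> r)"

definition itp_dist ::
    "'x set \<Rightarrow> (nat \<Rightarrow> 'x \<Rightarrow> complex) \<Rightarrow> 'x itp \<Rightarrow> 'x itp \<Rightarrow> real" where
  "itp_dist X \<phi> u v = itp_norm X (itp_add X \<phi> u (itp_scale X \<phi> (-1) v))"

text \<open>The elementary decomposable vector whose first \<open>k\<close> factors are \<open>\<psi> 0, \<dots>, \<psi> (k - 1)\<close>
  and whose remaining factors are \<open>\<phi> k, \<phi> (k + 1), \<dots>\<close>.\<close>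

definition itp_elem ::
    "'x set \<Rightarrow> (nat \<Rightarrow> 'x \<Rightarrow> complex) \<Rightarrow> nat \<Rightarrow> (nat \<Rightarrow> 'x \<Rightarrow> complex) \<Rightarrow> 'x itp" where
  "itp_elem X \<phi> k \<psi> = itp_rel X \<phi> `` {\<lambda>_. (k, tensor X k \<psi>)}"

section \<open>Infinite tensor products of operators\<close>

definition itp_bounded_op ::
    "'x set \<Rightarrow> (nat \<Rightarrow> 'x \<Rightarrow> complex) \<Rightarrow> ('x itp \<Rightarrow> 'x itp) \<Rightarrow> bool" where
  "itp_bounded_op X \<phi> S \<longleftrightarrow>
     (\<forall>u\<in>itp X \<phi>. S u \<in> itp X \<phi>) \<and>
     (\<forall>u\<in>itp X \<phi>. \<forall>v\<in>itp X \<phi>. S (itp_add X \<phi> u v) = itp_add X \<phi> (S u) (S v)) \<and>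
     (\<forall>c. \<forall>u\<in>itp X \<phi>. S (itp_scale X \<phi> c u) = itp_scale X \<phi> c (S u)) \<and>
     (\<exists>K. \<forall>u\<in>itp X \<phi>. itp_norm X (S u) \<le> K * itp_norm X u)"

text \<open>The bounded operator which acts as \<open>T i\<close> in the factors \<open>i \<in> J\<close> and as the identity in the
  others. Its values on \<open>itp X \<phi>\<close> are uniquely determined, since the elementary decomposable vectors
  have dense span; \<open>k\<close> may be taken large enough to cover \<open>J\<close> because any elementary decomposable
  vector can be written with a larger \<open>k\<close> by setting \<open>\<psi> i = \<phi> i\<close>.\<close>

definition itp_partial_op ::
    "'x set \<Rightarrow> (nat \<Rightarrow> 'x \<Rightarrow> complex) \<Rightarrow> (nat \<Rightarrow> ('x \<Rightarrow> complex) \<Rightarrow> 'x \<Rightarrow> complex) \<Rightarrow>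
      nat set \<Rightarrow> 'x itp \<Rightarrow> 'x itp" where
  "itp_partial_op X \<phi> T J =
     (SOME S. itp_bounded_op X \<phi> S \<and>
        (\<forall>k \<psi>. J \<subseteq> {..<k} \<and> (\<forall>i<k. \<psi> i \<in> ell2 X) \<longrightarrow>
           S (itp_elem X \<phi> k \<psi>) = itp_elem X \<phi> k (\<lambda>i. if i \<in> J then T i (\<psi> i) else \<psi> i)))"

text \<open>Existence of the infinite tensor product of the operators \<open>T i\<close>: strong convergence of the net
  of partial operators to a bounded operator. Only the tail of the net matters, so it is harmless
  that \<open>finite_subsets_at_top\<close> includes the empty set.\<close>

definition itp_op_exists ::
    "'x set \<Rightarrow> (nat \<Rightarrow> 'x \<Rightarrow> complex) \<Rightarrow> (nat \<Rightarrow> ('x \<Rightarrow> complex) \<Rightarrow> 'x \<Rightarrow> complex) \<Rightarrow> bool" where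
  "itp_op_exists X \<phi> T \<longleftrightarrow>
     (\<exists>S. itp_bounded_op X \<phi> S \<and>
        (\<forall>u\<in>itp X \<phi>.
           ((\<lambda>J. itp_dist X \<phi> (itp_partial_op X \<phi> T J u) (S u)) \<longlongrightarrow> 0)
             (finite_subsets_at_top UNIV)))"

definition itp_rep_exists ::
    "('g, 'm) monoid_scheme \<Rightarrow> 'x set \<Rightarrow> (nat \<Rightarrow> 'x \<Rightarrow> complex) \<Rightarrow>
      (nat \<Rightarrow> 'g \<Rightarrow> ('x \<Rightarrow> complex) \<Rightarrow> 'x \<Rightarrow> complex) \<Rightarrow> bool" where
  "itp_rep_exists G X \<phi> U \<longleftrightarrow> (\<forall>x\<in>carrier G. itp_op_exists X \<phi> (\<lambda>i. U i x))"

section \<open>The projective representation attached to a bilinear map\<close>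

definition circle_group :: "complex monoid" where
  "circle_group = \<lparr>carrier = sphere 0 1, mult = (*), one = 1\<rparr>"

definition bilinear_circle ::
    "('a, 'm) monoid_scheme \<Rightarrow> ('b, 'n) monoid_scheme \<Rightarrow> ('a \<Rightarrow> 'b \<Rightarrow> complex) \<Rightarrow> bool" where
  "bilinear_circle A B \<sigma> \<longleftrightarrow>
     (\<forall>b\<in>carrier B. (\<lambda>a. \<sigma> a b) \<in> hom A circle_group) \<and>
     (\<forall>a\<in>carrier A. (\<lambda>b. \<sigma> a b) \<in> hom B circle_group)"

definition left_translate ::
    "('b, 'n) monoid_scheme \<Rightarrow> 'b \<Rightarrow> ('b \<Rightarrow> 'c::zero) \<Rightarrow> 'b \<Rightarrow> 'c" where
  "left_translate B b f = (\<lambda>x. if x \<in> carrier B then f (inv\<^bsub>B\<^esub> b \<otimes>\<^bsub>B\<^esub> x) else 0)"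

definition V_op ::
    "('b, 'n) monoid_scheme \<Rightarrow> ('a \<Rightarrow> 'b \<Rightarrow> complex) \<Rightarrow> 'a \<Rightarrow> ('b \<Rightarrow> complex) \<Rightarrow> 'b \<Rightarrow> complex" where
  "V_op B \<sigma> a f = (\<lambda>x. if x \<in> carrier B then \<sigma> a x * f x else 0)"

definition U_op ::
    "('b, 'n) monoid_scheme \<Rightarrow> ('a \<Rightarrow> 'b \<Rightarrow> complex) \<Rightarrow> 'a \<times> 'b \<Rightarrow> ('b \<Rightarrow> complex) \<Rightarrow> 'b \<Rightarrow> complex" where
  "U_op B \<sigma> g = V_op B \<sigma> (fst g) \<circ> left_translate B (snd g)"

section \<open>Amenability and Foelner type sequences\<close>

definition ell_infty :: "'x set \<Rightarrow> ('x \<Rightarrow> real) set" where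
  "ell_infty X = {f. (\<forall>x. x \<notin> X \<longrightarrow> f x = 0) \<and> bounded (f ` X)}"

text \<open>Amenability of a discrete group: existence of a left invariant mean on the bounded real
  functions.\<close>

definition amenable :: "('b, 'n) monoid_scheme \<Rightarrow> bool" where
  "amenable B \<longleftrightarrow>
     (\<exists>M :: ('b \<Rightarrow> real) \<Rightarrow> real.
        (\<forall>f\<in>ell_infty (carrier B). \<forall>g\<in>ell_infty (carrier B). M (\<lambda>x. f x + g x) = M f + M g) \<and>
        (\<forall>c. \<forall>f\<in>ell_infty (carrier B). M (\<lambda>x. c * f x) = c * M f) \<and>
        (\<forall>f\<in>ell_infty (carrier B). (\<forall>x. 0 \<le> f x) \<longrightarrow> 0 \<le> M f) \<and>
        M (indicator (carrier B)) = 1 \<and>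
        (\<forall>b\<in>carrier B. \<forall>f\<in>ell_infty (carrier B). M (left_translate B b f) = M f))"

definition sigmaF_sequence :: "('b, 'n) monoid_scheme \<Rightarrow> (nat \<Rightarrow> 'b set) \<Rightarrow> bool" where
  "sigmaF_sequence B F \<longleftrightarrow>
     (\<forall>i. finite (F i) \<and> F i \<noteq> {} \<and> F i \<subseteq> carrier B) \<and>
     (\<forall>x\<in>carrier B.
        summable (\<lambda>i. \<bar>1 - real (card (F i \<inter> (x <#\<^bsub>B\<^esub> F i))) / real (card (F i))\<bar>))"

definition normalized_indicator :: "'b set \<Rightarrow> 'b \<Rightarrow> complex" where
  "normalized_indicator F = (\<lambda>x. indicator F x / complex_of_real (sqrt (real (card F))))"

end

theory Submission
  imports Defs
begin

text \<open>
  Write \<open>T i\<close> for the unitary \<open>U i x\<close>. On the inductive limit, applying the factors \<open>T i\<close> with \<open>i \<in> K\<close> to a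
  vector \<open>v\<close> of level at most \<open>min K\<close> moves it by a distance whose square is
  \<open>2 * \<parallel>v\<parallel>\<^sup>2 * (1 - Re (\<Prod>i\<in>K. z i))\<close> with \<open>z i = \<langle>T i (\<phi> i), \<phi> i\<rangle>\<close>. If the tensor product exists, singletons \<open>K\<close>
  give \<open>Re (z i) \<longrightarrow> 1\<close>. For \<open>x = (1, b)\<close> this says that the vectors \<open>\<phi> i\<close> are almost
  invariant under translations: a cluster point of the means \<open>f \<mapsto> \<Sum>x. f x * \<bar>\<phi> i x\<bar>\<^sup>2\<close> is an invariant mean,
  and every \<open>b\<close> is a quotient of two elements of the countable support of some \<open>\<phi> i\<close>.
  Conversely, \<open>\<bar>1 - (\<Prod>i\<in>K. z i)\<bar> \<le> (\<Sum>i\<in>K. \<bar>1 - z i\<bar>)\<close>, so summability of \<open>\<bar>1 - z i\<bar>\<close> makes the net of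
  partial operators strongly Cauchy, and the Foelner and \<open>\<sigma>\<close> conditions together bound that series.
\<close>

section \<open>Square-summable functions\<close>

text \<open>The partial operators are known only as a choice of some bounded operator with
  prescribed values on elementary decomposable vectors, so nothing can be computed before one such
  operator is exhibited and its uniqueness is proved by density. What makes it explicit is that each
  \<open>U i x\<close> is a substitution along a permutation of \<open>B\<close> followed by a
  unimodular multiplier: tensor products of such operators have the same form on tuples, and so are
  defined on all functions there and not only on elementary tensors. The product of the
  \<open>z i\<close> arises because inner products of elementary tensors factorize; and since the
  factors already applied are isometric, adding the factors in \<open>K\<close> to a partial product
  costs as much as applying them to \<open>v\<close> alone. The two halves use this differently: for
  necessity single factors tested on the vector built from all \<open>\<phi> i\<close> are enough,
  while sufficiency must control all finite blocks beyond some index. Means are followed along a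
  filter because there are uncountably many bounded functions, and one subsequence need not serve
  them all.\<close>

lemma ell2_norm_nonneg: "0 \<le> ell2_norm X f"
  by (simp add: ell2_norm_def infsum_nonneg)

lemma ell2_norm_sq: "(ell2_norm X f)\<^sup>2 = (\<Sum>\<^sub>\<infinity>x\<in>X. (cmod (f x))\<^sup>2)"
  by (simp add: ell2_norm_def infsum_nonneg)

lemma has_sum_ell2_norm:
  "f \<in> ell2 X \<Longrightarrow> ((\<lambda>x. (cmod (f x))\<^sup>2) has_sum (ell2_norm X f)\<^sup>2) X"
  by (simp add: ell2_norm_sq ell2_def)

lemma ell2_norm_eqI:
  assumes "((\<lambda>x. (cmod (f x))\<^sup>2) has_sum r\<^sup>2) X" "0 \<le> r"
  shows "ell2_norm X f = r"
  using infsumI[OF assms(1)] assms(2) by (simp add: ell2_norm_def)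

lemma ell2_outside: "f \<in> ell2 X \<Longrightarrow> x \<notin> X \<Longrightarrow> f x = 0"
  by (simp add: ell2_def)

lemma L2_set_le_ell2_norm:
  assumes "f \<in> ell2 X" "finite F" "F \<subseteq> X"
  shows "L2_set (\<lambda>x. cmod (f x)) F \<le> ell2_norm X f"
  unfolding L2_set_def ell2_norm_def
  using assms by (intro real_sqrt_le_mono finite_sum_le_infsum) (auto simp: ell2_def)

text \<open>Minkowski's inequality is at hand for finite sums as
  \<open>L2_set_triangle_ineq\<close>; testing on finite subsets carries it over to
  \<open>X\<close>.\<close>

lemma ell2_boundI:
  assumes "\<And>x. x \<notin> X \<Longrightarrow> f x = 0"
    and le: "\<And>F. finite F \<Longrightarrow> F \<subseteq> X \<Longrightarrow> L2_set (\<lambda>x. cmod (f x)) F \<le> r" and "0 \<le> r"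
  shows "f \<in> ell2 X" "ell2_norm X f \<le> r"
proof -
  have b: "(\<Sum>x\<in>F. (cmod (f x))\<^sup>2) \<le> r\<^sup>2" if "finite F" "F \<subseteq> X" for F
    using le[OF that] sqrt_le_D unfolding L2_set_def by blast
  have s: "(\<lambda>x. (cmod (f x))\<^sup>2) summable_on X"
    by (rule nonneg_bdd_above_summable_on) (auto intro!: bdd_aboveI2 b)
  then show "f \<in> ell2 X"
    using assms by (simp add: ell2_def)
  show "ell2_norm X f \<le> r"
    unfolding ell2_norm_def using \<open>0 \<le> r\<close> by (intro real_le_lsqrt infsum_le_finite_sums s b)
qed

lemma ell2_norm_zero [simp]: "ell2_norm X (\<lambda>_. 0) = 0"
  by (simp add: ell2_norm_def)

lemma ell2_add:
  assumes "f \<in> ell2 X" "g \<in> ell2 X"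
  shows "(\<lambda>x. f x + g x) \<in> ell2 X"
    and "ell2_norm X (\<lambda>x. f x + g x) \<le> ell2_norm X f + ell2_norm X g"
proof -
  have "L2_set (\<lambda>x. cmod (f x + g x)) F \<le> ell2_norm X f + ell2_norm X g"
    if "finite F" "F \<subseteq> X" for F
  proof -
    have "L2_set (\<lambda>x. cmod (f x + g x)) F \<le> L2_set (\<lambda>x. cmod (f x) + cmod (g x)) F"
      by (intro L2_set_mono norm_triangle_ineq norm_ge_zero)
    also have "\<dots> \<le> L2_set (\<lambda>x. cmod (f x)) F + L2_set (\<lambda>x. cmod (g x)) F"
      by (rule L2_set_triangle_ineq)
    also have "\<dots> \<le> ell2_norm X f + ell2_norm X g"
      using assms that by (intro add_mono L2_set_le_ell2_norm)
    finally show ?thesis .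
  qed
  then show "(\<lambda>x. f x + g x) \<in> ell2 X"
    "ell2_norm X (\<lambda>x. f x + g x) \<le> ell2_norm X f + ell2_norm X g"
    using assms by (auto intro!: ell2_boundI add_nonneg_nonneg ell2_norm_nonneg simp: ell2_outside)
qed

lemma ell2_scale:
  assumes "f \<in> ell2 X"
  shows "(\<lambda>x. c * f x) \<in> ell2 X" "ell2_norm X (\<lambda>x. c * f x) = cmod c * ell2_norm X f"
proof -
  have h: "((\<lambda>x. (cmod (c * f x))\<^sup>2) has_sum (cmod c * ell2_norm X f)\<^sup>2) X"
    using has_sum_cmult_right[OF has_sum_ell2_norm[OF assms], of "(cmod c)\<^sup>2"]
    by (simp add: norm_mult power_mult_distrib)
  then show "(\<lambda>x. c * f x) \<in> ell2 X"
    using assms by (auto simp: ell2_def has_sum_imp_summable)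
  show "ell2_norm X (\<lambda>x. c * f x) = cmod c * ell2_norm X f"
    by (rule ell2_norm_eqI[OF h]) (simp add: ell2_norm_nonneg)
qed

lemma ell2_diff:
  assumes "f \<in> ell2 X" "g \<in> ell2 X"
  shows "(\<lambda>x. f x - g x) \<in> ell2 X"
  using ell2_add(1)[OF assms(1) ell2_scale(1)[OF assms(2), of "-1"]] by simp

lemma ell2_norm_commute: "ell2_norm X (\<lambda>x. f x - g x) = ell2_norm X (\<lambda>x. g x - f x)"
  by (simp add: ell2_norm_def norm_minus_commute)

lemma ell2_triangle:
  assumes "f \<in> ell2 X" "g \<in> ell2 X" "h \<in> ell2 X"
  shows "ell2_norm X (\<lambda>x. f x - h x) \<le> ell2_norm X (\<lambda>x. f x - g x) + ell2_norm X (\<lambda>x. g x - h x)"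
  using ell2_add(2)[OF ell2_diff[OF assms(1,2)] ell2_diff[OF assms(2,3)]] by simp

lemma ell2_finite_support:
  assumes "finite F" "F \<subseteq> X"
  shows "(\<lambda>x. if x \<in> F then f x else 0) \<in> ell2 X"
proof -
  have "(\<lambda>x. (cmod (if x \<in> F then f x else 0))\<^sup>2) summable_on X"
    by (rule finite_nonzero_values_imp_summable_on) (rule finite_subset[OF _ assms(1)], auto)
  then show ?thesis
    using assms by (auto simp: ell2_def)
qed

lemma ell2_finite_approx:
  assumes "f \<in> ell2 X" "0 < e"
  obtains F where "finite F" "F \<subseteq> X" "ell2_norm X (\<lambda>x. f x - (if x \<in> F then f x else 0)) < e"
proof -
  let ?q = "\<lambda>x. (cmod (f x))\<^sup>2"
  have s: "?q summable_on X"
    using assms by (simp add: ell2_def)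
  \<comment> \<open>The approximation gives only a weak inequality, and for squares;
    \<open>e\<^sup>2 / 2\<close> leaves room for strictness.\<close>
  obtain F where F: "finite F" "F \<subseteq> X" "dist (sum ?q F) (infsum ?q X) \<le> e\<^sup>2 / 2"
    using infsum_finite_approximation[OF s, of "e\<^sup>2 / 2"] assms(2) by auto
  have "((\<lambda>x. (cmod (f x - (if x \<in> F then f x else 0)))\<^sup>2) has_sum (infsum ?q X - sum ?q F)) X"
  proof -
    have "(?q has_sum (infsum ?q X - sum ?q F)) (X - F)"
      using F s by (intro has_sum_Diff has_sum_infsum has_sum_finite) auto
    then show ?thesis
      by (rule has_sum_cong_neutral[THEN iffD1, rotated -1]) (use F in auto)
  qed
  from infsumI[OF this] have "(ell2_norm X (\<lambda>x. f x - (if x \<in> F then f x else 0)))\<^sup>2 \<le> e\<^sup>2 / 2"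
    using F(3) unfolding ell2_norm_sq dist_real_def by linarith
  also have "\<dots> < e\<^sup>2"
    using assms(2) by simp
  finally show ?thesis
    using that[OF F(1,2)] assms(2) power_less_imp_less_base by (metis less_eq_real_def)
qed

text \<open>Translations, multiplications by characters and their tensor products all have this
  form, so this is the common source of their isometry.\<close>

lemma ell2_reindex:
  assumes "bij_betw p X X" "\<And>x. x \<in> X \<Longrightarrow> cmod (s x) = 1" "f \<in> ell2 X"
  shows "(\<lambda>x. if x \<in> X then s x * f (p x) else 0) \<in> ell2 X"
    and "ell2_norm X (\<lambda>x. if x \<in> X then s x * f (p x) else 0) = ell2_norm X f"
proof -
  have "((\<lambda>x. (cmod (f (p x)))\<^sup>2) has_sum (ell2_norm X f)\<^sup>2) X"
    using has_sum_reindex_bij_betw[OF assms(1), of "\<lambda>x. (cmod (f x))\<^sup>2"] has_sum_ell2_norm[OF assms(3)]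
    by simp
  then have h: "((\<lambda>x. (cmod (if x \<in> X then s x * f (p x) else 0))\<^sup>2) has_sum (ell2_norm X f)\<^sup>2) X"
    by (rule has_sum_cong[THEN iffD1, rotated]) (simp add: norm_mult assms(2))
  then show "(\<lambda>x. if x \<in> X then s x * f (p x) else 0) \<in> ell2 X"
    by (auto simp: ell2_def has_sum_imp_summable)
  show "ell2_norm X (\<lambda>x. if x \<in> X then s x * f (p x) else 0) = ell2_norm X f"
    by (rule ell2_norm_eqI[OF h ell2_norm_nonneg])
qed

section \<open>Sums over products and tuples, norms of elementary tensors\<close>

lemma has_sum_times_complex:
  fixes g :: "'p \<Rightarrow> complex" and h :: "'x \<Rightarrow> complex"
  assumes "(g has_sum a) P" "(h has_sum b) X"
  shows "((\<lambda>(p, x). g p * h x) has_sum a * b) (P \<times> X)"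
proof (rule has_sum_SigmaI)
  show "((\<lambda>y. case (p, y) of (p, x) \<Rightarrow> g p * h x) has_sum g p * b) X" if "p \<in> P" for p
    using has_sum_cmult_right[OF assms(2)] by simp
  show "((\<lambda>p. g p * b) has_sum a * b) P"
    by (rule has_sum_cmult_left[OF assms(1)])
  \<comment> \<open>Iterated sums determine the value, but summability on the product must be shown
    separately; over the complex numbers it is absolute summability, and absolute values
    multiply.\<close>
  have g: "(\<lambda>p. norm (g p)) summable_on P" and h: "(\<lambda>x. norm (h x)) summable_on X"
    using assms by (auto simp: summable_on_iff_abs_summable_on_complex[symmetric] has_sum_imp_summable)
  have "(\<lambda>(p, x). norm (g p) * norm (h x)) summable_on (P \<times> X)"
  proof (rule summable_on_SigmaI)
    show "((\<lambda>y. case (p, y) of (p, x) \<Rightarrow> norm (g p) * norm (h x)) has_sum norm (g p) * infsum (\<lambda>x. norm (h x)) X) X" if "p \<in> P" for p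
      using has_sum_cmult_right[OF has_sum_infsum[OF h]] by simp
  qed (auto intro: summable_on_cmult_left g)
  then show "(\<lambda>(p, x). g p * h x) summable_on P \<times> X"
    by (simp add: summable_on_iff_abs_summable_on_complex case_prod_unfold norm_mult)
qed

lemma tuples_Suc_bij: "bij_betw (\<lambda>(xs, x). xs @ [x]) (tuples X m \<times> X) (tuples X (Suc m))"
proof (rule bij_betw_byWitness[where f' = "\<lambda>xs. (butlast xs, last xs)"])
  show "(\<lambda>xs. (butlast xs, last xs)) ` tuples X (Suc m) \<subseteq> tuples X m \<times> X"
    by (auto simp: tuples_def dest: in_set_butlastD) (metis last_in_set length_greater_0_conv subsetD zero_less_Suc)
qed (auto simp: tuples_def append_butlast_last_id simp flip: length_greater_0_conv)

text \<open>Splitting off the last entry turns the sum over tuples into a product of sums. As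
  \<open>g\<close> and \<open>h\<close> are arbitrary complex functions, squared norms and inner
  products are both instances.\<close>

lemma has_sum_tuples_prod:
  fixes g :: "'x list \<Rightarrow> complex" and h :: "nat \<Rightarrow> 'x \<Rightarrow> complex"
  assumes "n \<le> m" "(g has_sum a) (tuples X n)" "\<And>i. n \<le> i \<Longrightarrow> i < m \<Longrightarrow> (h i has_sum b i) X"
  shows "((\<lambda>xs. g (take n xs) * (\<Prod>i=n..<m. h i (xs ! i))) has_sum a * (\<Prod>i=n..<m. b i)) (tuples X m)"
  using assms(1,3)
proof (induction m rule: dec_induct)
  case base
  show ?case
    by (rule has_sum_cong[THEN iffD1, of _ g]) (use assms(2) in \<open>auto simp: tuples_def\<close>)
next
  case (step m)
  let ?F = "\<lambda>m xs. g (take n xs) * (\<Prod>i=n..<m. h i (xs ! i))"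
  have "((\<lambda>(xs, x). ?F m xs * h m x) has_sum (a * (\<Prod>i=n..<m. b i)) * b m) (tuples X m \<times> X)"
    using step by (intro has_sum_times_complex) auto
  moreover have "?F (Suc m) (xs @ [x]) = ?F m xs * h m x" if "xs \<in> tuples X m" for xs x
    using that step(1) by (simp add: tuples_def nth_append)
  moreover have "a * (\<Prod>i=n..<Suc m. b i) = (a * (\<Prod>i=n..<m. b i)) * b m"
    using step(1) by simp
  ultimately have "((\<lambda>q. ?F (Suc m) ((\<lambda>(xs, x). xs @ [x]) q)) has_sum (a * (\<Prod>i=n..<Suc m. b i))) (tuples X m \<times> X)"
    by (simp only:, elim has_sum_cong[THEN iffD1, rotated]) (auto simp del: prod.op_ivl_Suc)
  then show ?case
    by (rule has_sum_reindex_bij_betw[OF tuples_Suc_bij, where f = "?F (Suc m)", THEN iffD1])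
qed

lemma tensor_embed_ell2:
  assumes "n \<le> m" "f \<in> ell2 (tuples X n)" "\<And>i. n \<le> i \<Longrightarrow> i < m \<Longrightarrow> \<phi> i \<in> ell2 X"
  shows "tensor_embed X \<phi> n m f \<in> ell2 (tuples X m)"
    and "ell2_norm (tuples X m) (tensor_embed X \<phi> n m f)
       = ell2_norm (tuples X n) f * (\<Prod>i=n..<m. ell2_norm X (\<phi> i))"
proof -
  let ?r = "ell2_norm (tuples X n) f * (\<Prod>i=n..<m. ell2_norm X (\<phi> i))"
  have "((\<lambda>xs. complex_of_real ((cmod (f (take n xs)))\<^sup>2) * (\<Prod>i=n..<m. complex_of_real ((cmod (\<phi> i (xs ! i)))\<^sup>2)))
     has_sum of_real ((ell2_norm (tuples X n) f)\<^sup>2) * (\<Prod>i=n..<m. of_real ((ell2_norm X (\<phi> i))\<^sup>2))) (tuples X m)"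
    using assms by (intro has_sum_tuples_prod) (auto simp only: has_sum_of_real_iff intro!: has_sum_ell2_norm)
  then have "((\<lambda>xs. (cmod (f (take n xs)))\<^sup>2 * (\<Prod>i=n..<m. (cmod (\<phi> i (xs ! i)))\<^sup>2)) has_sum ?r\<^sup>2) (tuples X m)"
    by (simp only: of_real_mult[symmetric] of_real_prod[symmetric] has_sum_of_real_iff power_mult_distrib prod_power_distrib)
  then have h: "((\<lambda>xs. (cmod (tensor_embed X \<phi> n m f xs))\<^sup>2) has_sum ?r\<^sup>2) (tuples X m)"
    by (rule has_sum_cong[THEN iffD1, rotated])
      (simp add: tensor_embed_def norm_mult power_mult_distrib prod_power_distrib flip: prod_norm)
  then show "tensor_embed X \<phi> n m f \<in> ell2 (tuples X m)"
    by (auto simp: ell2_def tensor_embed_def has_sum_imp_summable)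
  show "ell2_norm (tuples X m) (tensor_embed X \<phi> n m f) = ?r"
    by (rule ell2_norm_eqI[OF h]) (simp add: ell2_norm_nonneg prod_nonneg)
qed

text \<open>An elementary tensor grows out of the unit vector at level 0, the function 1 on the
  empty tuple, so it inherits the properties of \<open>tensor_embed\<close>.\<close>

lemma tensor_eq_tensor_embed:
  "tensor X k \<psi> = tensor_embed X \<psi> 0 k (\<lambda>xs. if xs = [] then 1 else 0)"
  by (auto simp: tensor_def tensor_embed_def atLeast0LessThan)

lemma unit_ell2_tuples_0:
  "(\<lambda>xs. if xs = [] then 1 else 0) \<in> ell2 (tuples X 0)"
  "ell2_norm (tuples X 0) (\<lambda>xs. if xs = [] then 1 else 0) = 1"
proof -
  have "tuples X 0 = {[]}"
    by (auto simp: tuples_def)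
  then show "(\<lambda>xs. if xs = [] then 1 else 0) \<in> ell2 (tuples X 0)"
    "ell2_norm (tuples X 0) (\<lambda>xs. if xs = [] then 1 else 0) = 1"
    by (auto simp: ell2_def ell2_norm_def)
qed

lemma tensor_ell2:
  assumes "\<And>i. i < k \<Longrightarrow> \<psi> i \<in> ell2 X"
  shows "tensor X k \<psi> \<in> ell2 (tuples X k)"
    and "ell2_norm (tuples X k) (tensor X k \<psi>) = (\<Prod>i<k. ell2_norm X (\<psi> i))"
  using tensor_embed_ell2[OF le0 unit_ell2_tuples_0(1), where m = k and X = X and \<phi> = \<psi>] assms
  by (auto simp: tensor_eq_tensor_embed unit_ell2_tuples_0(2) atLeast0LessThan)

lemma tensor_embed_tensor_embed:
  assumes "n \<le> k" "k \<le> m"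
  shows "tensor_embed X \<phi> k m (tensor_embed X \<phi> n k f) = tensor_embed X \<phi> n m f"
proof
  fix xs
  show "tensor_embed X \<phi> k m (tensor_embed X \<phi> n k f) xs = tensor_embed X \<phi> n m f xs"
  proof (cases "xs \<in> tuples X m")
    case True
    then have "take k xs \<in> tuples X k"
      using assms by (auto simp: tuples_def dest: in_set_takeD)
    moreover have "(\<Prod>i=n..<k. \<phi> i (take k xs ! i)) = (\<Prod>i=n..<k. \<phi> i (xs ! i))"
      by (intro prod.cong) auto
    ultimately show ?thesis
      using True assms prod.atLeastLessThan_concat[of n k m "\<lambda>i. \<phi> i (xs ! i)"]
      by (simp add: tensor_embed_def min_def mult.assoc)
  qed (simp add: tensor_embed_def)
qed

lemma tensor_embed_self: "f \<in> ell2 (tuples X n) \<Longrightarrow> tensor_embed X \<phi> n n f = f"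
  by (rule ext) (auto simp: tensor_embed_def ell2_outside, auto simp: tuples_def)

lemma tensor_embed_add:
  "tensor_embed X \<phi> n m (\<lambda>xs. f xs + g xs) = (\<lambda>xs. tensor_embed X \<phi> n m f xs + tensor_embed X \<phi> n m g xs)"
  by (auto simp: tensor_embed_def distrib_right)

lemma tensor_embed_scale:
  "tensor_embed X \<phi> n m (\<lambda>xs. c * f xs) = (\<lambda>xs. c * tensor_embed X \<phi> n m f xs)"
  by (auto simp: tensor_embed_def)

section \<open>The inductive limit\<close>

locale unit_sequence =
  fixes X :: "'x set" and \<phi> :: "nat \<Rightarrow> 'x \<Rightarrow> complex"
  assumes unit_ell2: "\<phi> i \<in> ell2 X" and unit_norm: "ell2_norm X (\<phi> i) = 1"
begin

abbreviation C where "C \<equiv> ilim_carrier X"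
abbreviation CS where "CS \<equiv> ilim_Cauchy X \<phi>"
abbreviation d where "d \<equiv> ilim_dist X \<phi>"
abbreviation N where "N \<equiv> ilim_norm X"
abbreviation add where "add \<equiv> ilim_add X \<phi>"

text \<open>Several elements are compared at one common level; the function represents
  \<open>p\<close> there when \<open>fst p \<le> m\<close>.\<close>

definition lev :: "nat \<Rightarrow> 'x ilim \<Rightarrow> 'x list \<Rightarrow> complex" where
  "lev m p = tensor_embed X \<phi> (fst p) m (snd p)"

lemma lev_ell2: "p \<in> C \<Longrightarrow> fst p \<le> m \<Longrightarrow> lev m p \<in> ell2 (tuples X m)"
  unfolding lev_def by (intro tensor_embed_ell2) (auto simp: ilim_carrier_def unit_ell2)

lemma norm_lev: "p \<in> C \<Longrightarrow> fst p \<le> m \<Longrightarrow> ell2_norm (tuples X m) (lev m p) = N p"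
  unfolding lev_def ilim_norm_def
  by (subst tensor_embed_ell2) (auto simp: ilim_carrier_def unit_ell2 unit_norm)

lemma ilim_scale_carrier: "p \<in> C \<Longrightarrow> ilim_scale c p \<in> C"
  by (auto simp: ilim_carrier_def ilim_scale_def ell2_scale)

lemma ilim_add_eq: "add p q = (max (fst p) (fst q),
    \<lambda>xs. lev (max (fst p) (fst q)) p xs + lev (max (fst p) (fst q)) q xs)"
  by (simp add: ilim_add_def lev_def Let_def)

lemma ilim_add_carrier:
  assumes "p \<in> C" "q \<in> C"
  shows "add p q \<in> C"
proof -
  let ?m = "max (fst p) (fst q)"
  have "(\<lambda>xs. lev ?m p xs + lev ?m q xs) \<in> ell2 (tuples X ?m)"
    using assms by (intro ell2_add(1) lev_ell2) auto
  then show ?thesis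
    by (simp add: ilim_add_eq ilim_carrier_def)
qed

lemma fst_add: "fst (add p q) = max (fst p) (fst q)"
  by (simp add: ilim_add_eq)

lemma fst_scale: "fst (ilim_scale c p) = fst p"
  by (simp add: ilim_scale_def)

lemma lev_add: "fst p \<le> m \<Longrightarrow> fst q \<le> m \<Longrightarrow> lev m (add p q) = (\<lambda>xs. lev m p xs + lev m q xs)"
  by (simp add: ilim_add_eq lev_def tensor_embed_add tensor_embed_tensor_embed)

lemma lev_scale: "lev m (ilim_scale c p) = (\<lambda>xs. c * lev m p xs)"
  by (simp add: lev_def ilim_scale_def tensor_embed_scale)

lemmas carrier_intros = ilim_add_carrier ilim_scale_carrier

text \<open>Embeddings are isometric, so the distance may be computed at any level above both
  elements. Choosing one level for all elements at hand reduces the metric laws to those of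
  l2.\<close>

lemma dist_lev:
  assumes "p \<in> C" "q \<in> C" "fst p \<le> m" "fst q \<le> m"
  shows "d p q = ell2_norm (tuples X m) (\<lambda>xs. lev m p xs - lev m q xs)"
  unfolding ilim_dist_def using assms
  by (subst norm_lev[where m = m, symmetric])
    (auto simp: lev_add lev_scale fst_add fst_scale intro!: carrier_intros)

lemma dist_nonneg: "0 \<le> d p q"
  by (simp add: ilim_dist_def ilim_norm_def ell2_norm_nonneg)

lemma dist_self: "p \<in> C \<Longrightarrow> d p p = 0"
  by (subst dist_lev[where m = "fst p"]) auto

lemma dist_commute: "p \<in> C \<Longrightarrow> q \<in> C \<Longrightarrow> d p q = d q p"
  by (subst (1 2) dist_lev[where m = "max (fst p) (fst q)"]) (auto intro: ell2_norm_commute)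

lemma dist_triangle:
  assumes "p \<in> C" "q \<in> C" "r \<in> C"
  shows "d p r \<le> d p q + d q r"
proof -
  define m where "m = max (fst p) (max (fst q) (fst r))"
  have m: "fst p \<le> m" "fst q \<le> m" "fst r \<le> m"
    by (auto simp: m_def)
  show ?thesis
    using ell2_triangle[OF lev_ell2 lev_ell2 lev_ell2, OF assms(1) m(1) assms(2) m(2) assms(3) m(3)]
    by (simp add: dist_lev[where m = m] assms m)
qed

lemma dist_add:
  assumes "p \<in> C" "q \<in> C" "p' \<in> C" "q' \<in> C"
  shows "d (add p q) (add p' q') \<le> d p p' + d q q'"
proof -
  define m where "m = max (max (fst p) (fst q)) (max (fst p') (fst q'))"
  have m: "fst p \<le> m" "fst q \<le> m" "fst p' \<le> m" "fst q' \<le> m"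
    by (auto simp: m_def)
  have "d (add p q) (add p' q') = ell2_norm (tuples X m)
      (\<lambda>xs. (lev m p xs - lev m p' xs) + (lev m q xs - lev m q' xs))"
    by (subst dist_lev[where m = m]) (simp_all add: carrier_intros assms m fst_add lev_add algebra_simps)
  also have "\<dots> \<le> d p p' + d q q'"
    by (subst (1 2) dist_lev[where m = m], simp_all add: assms m)
      (intro ell2_add ell2_diff lev_ell2 assms m)
  finally show ?thesis .
qed

lemma dist_scale:
  assumes "p \<in> C" "q \<in> C"
  shows "d (ilim_scale c p) (ilim_scale c q) = cmod c * d p q"
proof -
  define m where "m = max (fst p) (fst q)"
  have m: "fst p \<le> m" "fst q \<le> m"
    by (auto simp: m_def)
  have "ell2_norm (tuples X m) (\<lambda>xs. c * (lev m p xs - lev m q xs)) = cmod c * d p q"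
    by (simp add: dist_lev[OF assms m] ell2_scale ell2_diff lev_ell2 assms m)
  then show ?thesis
    by (simp add: dist_lev[where m = m] fst_scale carrier_intros assms m lev_scale right_diff_distrib)
qed

text \<open>Scaling by 0 gives a representative of the zero vector, which turns norms into
  distances; \<open>convergent_dist\<close> then covers norms as well.\<close>

lemma dist_zero: "p \<in> C \<Longrightarrow> q \<in> C \<Longrightarrow> d p (ilim_scale 0 q) = N p"
  by (subst dist_lev[where m = "max (fst p) (fst q)"])
    (auto simp: fst_scale lev_scale carrier_intros norm_lev)

lemma norm_diff_le_dist:
  assumes "p \<in> C" "q \<in> C"
  shows "\<bar>N p - N q\<bar> \<le> d p q"
proof -
  let ?z = "ilim_scale 0 p"
  have z: "?z \<in> C"
    by (simp add: carrier_intros assms)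
  have "d p ?z \<le> d p q + d q ?z" "d q ?z \<le> d q p + d p ?z"
    by (simp_all add: dist_triangle assms z)
  then show ?thesis
    using dist_commute[OF assms] by (simp add: dist_zero assms)
qed

lemma dist_diff_le:
  assumes "p \<in> C" "q \<in> C" "p' \<in> C" "q' \<in> C"
  shows "\<bar>d p q - d p' q'\<bar> \<le> d p p' + d q q'"
  using dist_triangle[of p p' q] dist_triangle[of p' q' q] dist_triangle[of p' p q']
    dist_triangle[of p q q'] dist_commute[of p p'] dist_commute[of q q'] assms by linarith

section \<open>The completion\<close>

definition cls :: "(nat \<Rightarrow> 'x ilim) \<Rightarrow> 'x itp" where
  "cls p = itp_rel X \<phi> `` {p}"

lemma CS_carrier: "p \<in> CS \<Longrightarrow> p k \<in> C"
  by (simp add: ilim_Cauchy_def)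

lemma CS_dist:
  assumes "p \<in> CS" "0 < e"
  obtains M where "\<And>m n. M \<le> m \<Longrightarrow> M \<le> n \<Longrightarrow> d (p m) (p n) < e"
  using assms unfolding ilim_Cauchy_def by blast

lemma CS_I:
  assumes "\<And>k. p k \<in> C" "\<And>e. 0 < e \<Longrightarrow> \<exists>M. \<forall>m\<ge>M. \<forall>n\<ge>M. d (p m) (p n) < e"
  shows "p \<in> CS"
  using assms by (simp add: ilim_Cauchy_def)

lemma CS_const: "x \<in> C \<Longrightarrow> (\<lambda>_. x) \<in> CS"
  by (simp add: ilim_Cauchy_def dist_self)

lemma CS_add:
  assumes "p \<in> CS" "q \<in> CS"
  shows "(\<lambda>k. add (p k) (q k)) \<in> CS"
proof (rule CS_I)
  fix e :: real assume "0 < e"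
  then have "0 < e / 2" by simp
  obtain M where M: "\<And>m n. M \<le> m \<Longrightarrow> M \<le> n \<Longrightarrow> d (p m) (p n) < e / 2"
    using CS_dist[OF assms(1) \<open>0 < e / 2\<close>] by blast
  obtain M' where M': "\<And>m n. M' \<le> m \<Longrightarrow> M' \<le> n \<Longrightarrow> d (q m) (q n) < e / 2"
    using CS_dist[OF assms(2) \<open>0 < e / 2\<close>] by blast
  have "d (add (p m) (q m)) (add (p n) (q n)) < e" if "max M M' \<le> m" "max M M' \<le> n" for m n
    using dist_add[of "p m" "q m" "p n" "q n"] M[of m n] M'[of m n] that assms[THEN CS_carrier]
    by (fastforce simp: CS_carrier)
  then show "\<exists>M. \<forall>m\<ge>M. \<forall>n\<ge>M. d (add (p m) (q m)) (add (p n) (q n)) < e"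
    by blast
qed (simp add: carrier_intros CS_carrier assms)

lemma CS_scale:
  assumes "p \<in> CS"
  shows "(\<lambda>k. ilim_scale c (p k)) \<in> CS"
proof (rule CS_I)
  fix e :: real assume "0 < e"
  then have e: "0 < e / (cmod c + 1)"
    by (simp add: add_nonneg_pos)
  obtain M where M: "\<And>m n. M \<le> m \<Longrightarrow> M \<le> n \<Longrightarrow> d (p m) (p n) < e / (cmod c + 1)"
    using CS_dist[OF assms e] by blast
  have "d (ilim_scale c (p m)) (ilim_scale c (p n)) < e" if "M \<le> m" "M \<le> n" for m n
  proof -
    have "cmod c * d (p m) (p n) \<le> (cmod c + 1) * d (p m) (p n)"
      by (simp add: mult_right_mono dist_nonneg)
    also have "\<dots> < e"
      using M[OF that] by (subst (asm) pos_less_divide_eq) (simp_all add: add_nonneg_pos mult.commute)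
    finally show ?thesis
      by (simp add: dist_scale CS_carrier assms)
  qed
  then show "\<exists>M. \<forall>m\<ge>M. \<forall>n\<ge>M. d (ilim_scale c (p m)) (ilim_scale c (p n)) < e"
    by blast
qed (simp add: carrier_intros CS_carrier assms)

lemma convergent_dist:
  assumes "p \<in> CS" "q \<in> CS"
  shows "convergent (\<lambda>k. d (p k) (q k))"
proof (rule Cauchy_convergent, rule metric_CauchyI)
  fix e :: real assume "0 < e"
  then have "0 < e / 2" by simp
  obtain M where M: "\<And>m n. M \<le> m \<Longrightarrow> M \<le> n \<Longrightarrow> d (p m) (p n) < e / 2"
    using CS_dist[OF assms(1) \<open>0 < e / 2\<close>] by blast
  obtain M' where M': "\<And>m n. M' \<le> m \<Longrightarrow> M' \<le> n \<Longrightarrow> d (q m) (q n) < e / 2"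
    using CS_dist[OF assms(2) \<open>0 < e / 2\<close>] by blast
  have "dist (d (p m) (q m)) (d (p n) (q n)) < e" if "max M M' \<le> m" "max M M' \<le> n" for m n
    using dist_diff_le[of "p m" "q m" "p n" "q n"] M[of m n] M'[of m n] that
    by (simp add: dist_real_def CS_carrier assms)
  then show "\<exists>M. \<forall>m\<ge>M. \<forall>n\<ge>M. dist (d (p m) (q m)) (d (p n) (q n)) < e"
    by blast
qed

lemma tendsto_dist_trans:
  assumes "p \<in> CS" "q \<in> CS" "r \<in> CS"
    "(\<lambda>k. d (p k) (q k)) \<longlonglongrightarrow> 0" "(\<lambda>k. d (q k) (r k)) \<longlonglongrightarrow> 0"
  shows "(\<lambda>k. d (p k) (r k)) \<longlonglongrightarrow> 0"
proof (rule tendsto_sandwich[OF _ _ tendsto_const tendsto_add_zero[OF assms(4,5)]])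
qed (auto intro!: always_eventually dist_nonneg dist_triangle simp: CS_carrier assms)

lemma equiv_itp_rel: "equiv CS (itp_rel X \<phi>)"
proof (rule equivI)
  show "itp_rel X \<phi> \<subseteq> CS \<times> CS"
    by (auto simp: itp_rel_def)
  show "refl_on CS (itp_rel X \<phi>)"
    by (auto simp: refl_on_def itp_rel_def dist_self CS_carrier)
  show "sym (itp_rel X \<phi>)"
    by (auto simp: sym_def itp_rel_def dist_commute CS_carrier)
  show "trans (itp_rel X \<phi>)"
    by (auto simp: trans_def itp_rel_def intro: tendsto_dist_trans)
qed

lemma cls_eq_iff: "p \<in> CS \<Longrightarrow> q \<in> CS \<Longrightarrow> cls p = cls q \<longleftrightarrow> (\<lambda>k. d (p k) (q k)) \<longlonglongrightarrow> 0"
  unfolding cls_def by (subst eq_equiv_class_iff[OF equiv_itp_rel]) (auto simp: itp_rel_def)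

lemma in_cls_iff: "p \<in> CS \<Longrightarrow> q \<in> cls p \<longleftrightarrow> q \<in> CS \<and> cls q = cls p"
  using cls_eq_iff by (auto simp: cls_def itp_rel_def dist_commute CS_carrier)

lemma cls_itp: "p \<in> CS \<Longrightarrow> cls p \<in> itp X \<phi>"
  by (auto simp: itp_def cls_def quotient_def)

lemma itpE: assumes "u \<in> itp X \<phi>" obtains p where "p \<in> CS" "u = cls p"
  using assms by (auto simp: itp_def cls_def quotient_def)

lemma cls_add_cong:
  assumes "p \<in> CS" "q \<in> CS" "p' \<in> CS" "q' \<in> CS" "cls p = cls p'" "cls q = cls q'"
  shows "cls (\<lambda>k. add (p k) (q k)) = cls (\<lambda>k. add (p' k) (q' k))"
proof -
  have "(\<lambda>k. d (p k) (p' k)) \<longlonglongrightarrow> 0" "(\<lambda>k. d (q k) (q' k)) \<longlonglongrightarrow> 0"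
    using assms by (simp_all add: cls_eq_iff)
  from tendsto_add_zero[OF this] have "(\<lambda>k. d (add (p k) (q k)) (add (p' k) (q' k))) \<longlonglongrightarrow> 0"
    by (rule tendsto_sandwich[OF _ _ tendsto_const, rotated 2])
      (auto intro!: always_eventually dist_nonneg dist_add simp: CS_carrier assms)
  then show ?thesis
    by (simp add: cls_eq_iff CS_add assms)
qed

lemma cls_scale_cong:
  assumes "p \<in> CS" "p' \<in> CS" "cls p = cls p'"
  shows "cls (\<lambda>k. ilim_scale c (p k)) = cls (\<lambda>k. ilim_scale c (p' k))"
  using assms tendsto_mult_right_zero[of "\<lambda>k. d (p k) (p' k)" sequentially "cmod c"]
  by (simp add: cls_eq_iff CS_scale dist_scale CS_carrier)

lemma itp_add_cls:
  assumes "p \<in> CS" "q \<in> CS"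
  shows "itp_add X \<phi> (cls p) (cls q) = cls (\<lambda>k. add (p k) (q k))"
proof -
  have self: "p \<in> cls p" "q \<in> cls q"
    by (simp_all add: in_cls_iff assms)
  have eq: "cls (\<lambda>k. add (p' k) (q' k)) = cls (\<lambda>k. add (p k) (q k))" if "p' \<in> cls p" "q' \<in> cls q" for p' q'
    using that assms by (intro cls_add_cong) (simp_all add: in_cls_iff)
  show ?thesis
    unfolding itp_add_def cls_def[symmetric] by (intro UN_constant_eq[OF self(1)] UN_constant_eq[OF self(2)] ballI eq)
qed

lemma itp_scale_cls:
  assumes "p \<in> CS"
  shows "itp_scale X \<phi> c (cls p) = cls (\<lambda>k. ilim_scale c (p k))"
  unfolding itp_scale_def cls_def[symmetric]
  using assms by (intro UN_constant_eq[of p] ballI cls_scale_cong) (simp_all add: in_cls_iff)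

text \<open>The description by \<open>THE\<close> is meaningful because norms converge along a
  Cauchy sequence and equivalent sequences share the limit.\<close>

lemma itp_norm_cls:
  assumes "p \<in> CS"
  shows "(\<lambda>k. N (p k)) \<longlonglongrightarrow> itp_norm X (cls p)"
proof -
  have "(\<lambda>k. ilim_scale 0 (p k)) \<in> CS"
    by (simp add: CS_scale assms)
  from convergent_dist[OF assms this] have "convergent (\<lambda>k. N (p k))"
    by (simp add: dist_zero CS_carrier assms)
  then obtain r where r: "(\<lambda>k. N (p k)) \<longlonglongrightarrow> r"
    by (auto simp: convergent_def)
  have unique: "s = r" if q: "q \<in> cls p" and s: "(\<lambda>k. N (q k)) \<longlonglongrightarrow> s" for q s
  proof -
    have q: "q \<in> CS" "cls q = cls p"
      using q assms by (auto simp: in_cls_iff)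
    then have "(\<lambda>k. d (q k) (p k)) \<longlonglongrightarrow> 0"
      using assms by (simp add: cls_eq_iff)
    then have "(\<lambda>k. N (q k) - N (p k)) \<longlonglongrightarrow> 0"
      by (rule Lim_null_comparison[OF always_eventually, rotated])
        (simp add: norm_diff_le_dist CS_carrier q assms)
    then show "s = r"
      using LIMSEQ_unique[OF tendsto_diff[OF s r]] by fastforce
  qed
  have "p \<in> cls p"
    by (simp add: in_cls_iff assms)
  then have "itp_norm X (cls p) = r"
    unfolding itp_norm_def using r unique by (intro the_equality) blast+
  then show ?thesis
    using r by simp
qed

lemma itp_dist_cls:
  assumes "p \<in> CS" "q \<in> CS"
  shows "(\<lambda>k. d (p k) (q k)) \<longlonglongrightarrow> itp_dist X \<phi> (cls p) (cls q)"
  unfolding itp_dist_def ilim_dist_def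
  by (simp add: itp_scale_cls itp_add_cls itp_norm_cls CS_add CS_scale assms)

lemma itp_dist_nonneg: "u \<in> itp X \<phi> \<Longrightarrow> v \<in> itp X \<phi> \<Longrightarrow> 0 \<le> itp_dist X \<phi> u v"
  by (elim itpE) (auto intro!: LIMSEQ_le_const[OF itp_dist_cls] simp: dist_nonneg)

lemma itp_dist_triangle:
  assumes "u \<in> itp X \<phi>" "v \<in> itp X \<phi>" "w \<in> itp X \<phi>"
  shows "itp_dist X \<phi> u w \<le> itp_dist X \<phi> u v + itp_dist X \<phi> v w"
proof -
  obtain p q r where pqr: "p \<in> CS" "u = cls p" "q \<in> CS" "v = cls q" "r \<in> CS" "w = cls r"
    using assms by (metis itpE)
  show ?thesis
    unfolding pqr
    by (rule LIMSEQ_le[OF itp_dist_cls tendsto_add[OF itp_dist_cls itp_dist_cls]])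
      (auto simp: pqr intro!: dist_triangle CS_carrier)
qed

lemma itp_dist_commute:
  assumes "u \<in> itp X \<phi>" "v \<in> itp X \<phi>"
  shows "itp_dist X \<phi> u v = itp_dist X \<phi> v u"
proof -
  obtain p q where pq: "p \<in> CS" "u = cls p" "q \<in> CS" "v = cls q"
    using assms by (metis itpE)
  have "(\<lambda>k. d (p k) (q k)) = (\<lambda>k. d (q k) (p k))"
    by (simp add: dist_commute CS_carrier pq)
  then show ?thesis
    using LIMSEQ_unique[OF itp_dist_cls[of p q]] itp_dist_cls[of q p] pq by simp
qed

lemma itp_dist_eq_0:
  assumes "u \<in> itp X \<phi>" "v \<in> itp X \<phi>" "itp_dist X \<phi> u v = 0"
  shows "u = v"
proof -
  obtain p q where pq: "p \<in> CS" "u = cls p" "q \<in> CS" "v = cls q"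
    using assms by (metis itpE)
  show ?thesis
    using itp_dist_cls[of p q] assms(3) by (simp add: pq cls_eq_iff)
qed

lemma itp_dist_const: "x \<in> C \<Longrightarrow> y \<in> C \<Longrightarrow> itp_dist X \<phi> (cls (\<lambda>_. x)) (cls (\<lambda>_. y)) = d x y"
  using itp_dist_cls[OF CS_const CS_const] by (simp add: LIMSEQ_const_iff)

lemma cls_const_eq: "x \<in> C \<Longrightarrow> y \<in> C \<Longrightarrow> d x y = 0 \<Longrightarrow> cls (\<lambda>_. x) = cls (\<lambda>_. y)"
  by (simp add: cls_eq_iff CS_const)

text \<open>A Cauchy sequence is approximated by its own late terms, seen as constant sequences;
  this is the density of the inductive limit in the completion.\<close>

lemma cls_const_dense:
  assumes "p \<in> CS" "0 < e"
  obtains M where "\<And>k. M \<le> k \<Longrightarrow> itp_dist X \<phi> (cls p) (cls (\<lambda>_. p k)) < e"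
proof -
  have "0 < e / 2"
    using assms(2) by simp
  then obtain M where M: "\<And>m n. M \<le> m \<Longrightarrow> M \<le> n \<Longrightarrow> d (p m) (p n) < e / 2"
    using CS_dist[OF assms(1)] by blast
  have "itp_dist X \<phi> (cls p) (cls (\<lambda>_. p k)) < e" if "M \<le> k" for k
  proof -
    have "itp_dist X \<phi> (cls p) (cls (\<lambda>_. p k)) \<le> e / 2"
      using M that
      by (intro LIMSEQ_le_const2[OF itp_dist_cls])
        (auto simp: assms CS_const CS_carrier intro!: less_imp_le exI[of _ M])
    then show ?thesis
      using assms(2) by simp
  qed
  then show ?thesis
    using that by blast
qed

lemma itp_elem_eq: "itp_elem X \<phi> k \<psi> = cls (\<lambda>_. (k, tensor X k \<psi>))"
  by (simp add: itp_elem_def cls_def)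

lemma tensor_carrier: "(\<And>i. i < k \<Longrightarrow> \<psi> i \<in> ell2 X) \<Longrightarrow> (k, tensor X k \<psi>) \<in> C"
  by (auto simp: ilim_carrier_def intro: tensor_ell2)

lemma itp_bounded_op_dist:
  assumes "itp_bounded_op X \<phi> S"
  obtains K where "0 < K" "\<And>u v. u \<in> itp X \<phi> \<Longrightarrow> v \<in> itp X \<phi> \<Longrightarrow>
    itp_dist X \<phi> (S u) (S v) \<le> K * itp_dist X \<phi> u v"
proof -
  obtain K where K: "\<And>u. u \<in> itp X \<phi> \<Longrightarrow> itp_norm X (S u) \<le> K * itp_norm X u"
    using assms unfolding itp_bounded_op_def by blast
  \<comment> \<open>\<open>max 1 K\<close> is positive whatever \<open>K\<close> is, which permits
    division by such constants later.\<close>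
  have "itp_dist X \<phi> (S u) (S v) \<le> max 1 K * itp_dist X \<phi> u v" if uv: "u \<in> itp X \<phi>" "v \<in> itp X \<phi>" for u v
  proof -
    have closed: "itp_scale X \<phi> (-1) v \<in> itp X \<phi>" "itp_add X \<phi> u (itp_scale X \<phi> (-1) v) \<in> itp X \<phi>"
      using uv by (auto elim!: itpE simp: itp_scale_cls itp_add_cls CS_scale CS_add intro!: cls_itp)
    have "itp_dist X \<phi> (S u) (S v) = itp_norm X (S (itp_add X \<phi> u (itp_scale X \<phi> (-1) v)))"
      using assms uv closed by (simp add: itp_bounded_op_def itp_dist_def)
    also have "\<dots> \<le> K * itp_dist X \<phi> u v"
      using K[OF closed(2)] by (simp add: itp_dist_def)
    also have "\<dots> \<le> max 1 K * itp_dist X \<phi> u v"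
      using uv by (intro mult_right_mono itp_dist_nonneg) auto
    finally show ?thesis .
  qed
  then show ?thesis
    using that[of "max 1 K"] by simp
qed

section \<open>Operators on the completion\<close>

text \<open>Distance 0 is equality in the inductive limit, so additivity and homogeneity are
  required only in that sense.\<close>

definition ilim_isometry :: "('x ilim \<Rightarrow> 'x ilim) \<Rightarrow> bool" where
  "ilim_isometry R \<longleftrightarrow>
     (\<forall>x\<in>C. R x \<in> C \<and> N (R x) = N x) \<and>
     (\<forall>x\<in>C. \<forall>y\<in>C. d (R x) (R y) = d x y \<and> d (R (add x y)) (add (R x) (R y)) = 0) \<and>
     (\<forall>c. \<forall>x\<in>C. d (R (ilim_scale c x)) (ilim_scale c (R x)) = 0)"

text \<open>The operator induced by a pointwise Cauchy sequence of isometries is defined on representatives by a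
  diagonal sequence; its limit is therefore available without proving completeness.\<close>

definition ilim_lift :: "(nat \<Rightarrow> 'x ilim \<Rightarrow> 'x ilim) \<Rightarrow> 'x itp \<Rightarrow> 'x itp" where
  "ilim_lift Q u = (\<Union>p\<in>u. cls (\<lambda>k. Q k (p k)))"

context
  fixes Q
  assumes isom: "\<And>k. ilim_isometry (Q k)" and Cauchy: "\<And>x. x \<in> C \<Longrightarrow> (\<lambda>k. Q k x) \<in> CS"
begin

lemma lift_carrier: "x \<in> C \<Longrightarrow> Q k x \<in> C" and lift_dist: "x \<in> C \<Longrightarrow> y \<in> C \<Longrightarrow> d (Q k x) (Q k y) = d x y"
  using isom by (auto simp: ilim_isometry_def)

lemma lift_CS:
  assumes "p \<in> CS"
  shows "(\<lambda>k. Q k (p k)) \<in> CS"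
proof (rule CS_I)
  fix e :: real assume "0 < e"
  then have e: "0 < e / 3" by simp
  obtain M where M: "\<And>m n. M \<le> m \<Longrightarrow> M \<le> n \<Longrightarrow> d (p m) (p n) < e / 3"
    using CS_dist[OF assms e] by blast
  obtain M' where M': "\<And>m n. M' \<le> m \<Longrightarrow> M' \<le> n \<Longrightarrow> d (Q m (p M)) (Q n (p M)) < e / 3"
    using CS_dist[OF Cauchy[OF CS_carrier[OF assms]] e] by blast
  have "d (Q m (p m)) (Q n (p n)) < e" if "max M M' \<le> m" "max M M' \<le> n" for m n
  proof -
    note [simp] = lift_carrier CS_carrier[OF assms]
    have "d (Q m (p m)) (Q n (p n)) \<le> d (Q m (p m)) (Q m (p M)) + d (Q m (p M)) (Q n (p n))"
      by (simp add: dist_triangle)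
    also have "\<dots> \<le> d (Q m (p m)) (Q m (p M)) + (d (Q m (p M)) (Q n (p M)) + d (Q n (p M)) (Q n (p n)))"
      by (simp add: dist_triangle)
    also have "\<dots> < e / 3 + (e / 3 + e / 3)"
      using that M[of m M] M[of M n] M'[of m n] by (intro add_strict_mono) (simp_all add: lift_dist)
    finally show ?thesis by simp
  qed
  then show "\<exists>M. \<forall>m\<ge>M. \<forall>n\<ge>M. d (Q m (p m)) (Q n (p n)) < e"
    by blast
qed (simp add: lift_carrier CS_carrier assms)

lemma ilim_lift_cls:
  assumes "p \<in> CS"
  shows "ilim_lift Q (cls p) = cls (\<lambda>k. Q k (p k))"
  unfolding ilim_lift_def using assms
  by (intro UN_constant_eq[of p] ballI) (simp add: in_cls_iff, clarsimp simp: in_cls_iff, simp add: cls_eq_iff lift_CS lift_dist CS_carrier)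

lemma ilim_lift_bounded_op: "itp_bounded_op X \<phi> (ilim_lift Q)"
proof -
  have "ilim_lift Q (itp_add X \<phi> (cls p) (cls q)) = itp_add X \<phi> (ilim_lift Q (cls p)) (ilim_lift Q (cls q))"
    if "p \<in> CS" "q \<in> CS" for p q
    using that isom
    by (simp add: itp_add_cls ilim_lift_cls CS_add lift_CS cls_eq_iff ilim_isometry_def CS_carrier)
  moreover have "ilim_lift Q (itp_scale X \<phi> c (cls p)) = itp_scale X \<phi> c (ilim_lift Q (cls p))"
    if "p \<in> CS" for p c
    using that isom
    by (simp add: itp_scale_cls ilim_lift_cls CS_scale lift_CS cls_eq_iff ilim_isometry_def CS_carrier)
  moreover have "itp_norm X (ilim_lift Q (cls p)) = itp_norm X (cls p)" if "p \<in> CS" for p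
    using itp_norm_cls[OF that] itp_norm_cls[OF lift_CS[OF that]] isom that
    by (simp add: ilim_lift_cls ilim_isometry_def CS_carrier LIMSEQ_unique)
  then have "\<exists>K. \<forall>u\<in>itp X \<phi>. itp_norm X (ilim_lift Q u) \<le> K * itp_norm X u"
    by (intro exI[of _ 1]) (auto elim!: itpE)
  ultimately show ?thesis
    unfolding itp_bounded_op_def
    by (auto elim!: itpE simp: ilim_lift_cls lift_CS cls_itp)
qed

end

end

section \<open>Tensor products of monomial unitaries\<close>

text \<open>The AM-GM inequality stands in for Cauchy-Schwarz: it gives summability, and for unit
  vectors it yields the same bound 1.\<close>

lemma has_sum_inner_ell2:
  assumes "f \<in> ell2 X" "g \<in> ell2 X"
  shows "((\<lambda>x. f x * cnj (g x)) has_sum (\<Sum>\<^sub>\<infinity>x\<in>X. f x * cnj (g x))) X"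
    and "cmod (\<Sum>\<^sub>\<infinity>x\<in>X. f x * cnj (g x)) \<le> ((ell2_norm X f)\<^sup>2 + (ell2_norm X g)\<^sup>2) / 2"
proof -
  have sq: "((\<lambda>x. ((cmod (f x))\<^sup>2 + (cmod (g x))\<^sup>2) / 2) has_sum
      ((ell2_norm X f)\<^sup>2 + (ell2_norm X g)\<^sup>2) / 2) X"
    by (intro has_sum_divide_const has_sum_add has_sum_ell2_norm assms)
  have le: "cmod (f x * cnj (g x)) \<le> ((cmod (f x))\<^sup>2 + (cmod (g x))\<^sup>2) / 2" for x
    using sum_squares_bound[of "cmod (f x)" "cmod (g x)"] by (simp add: norm_mult)
  have abs: "(\<lambda>x. cmod (f x * cnj (g x))) summable_on X"
    using has_sum_imp_summable[OF sq] by (rule summable_on_comparison_test) (use le in auto)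
  show "((\<lambda>x. f x * cnj (g x)) has_sum (\<Sum>\<^sub>\<infinity>x\<in>X. f x * cnj (g x))) X"
    by (rule has_sum_infsum[OF abs_summable_summable[OF abs]])
  have "cmod (\<Sum>\<^sub>\<infinity>x\<in>X. f x * cnj (g x)) \<le> (\<Sum>\<^sub>\<infinity>x\<in>X. cmod (f x * cnj (g x)))"
    by (rule norm_infsum_bound[OF abs])
  also have "\<dots> \<le> ((ell2_norm X f)\<^sup>2 + (ell2_norm X g)\<^sup>2) / 2"
    by (rule has_sum_mono[OF has_sum_infsum[OF abs] sq le])
  finally show "cmod (\<Sum>\<^sub>\<infinity>x\<in>X. f x * cnj (g x)) \<le> ((ell2_norm X f)\<^sup>2 + (ell2_norm X g)\<^sup>2) / 2" .
qed

lemma ell2_norm_diff_sq: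
  assumes "f \<in> ell2 X" "g \<in> ell2 X" "((\<lambda>x. f x * cnj (g x)) has_sum c) X"
  shows "(ell2_norm X (\<lambda>x. f x - g x))\<^sup>2 = (ell2_norm X f)\<^sup>2 + (ell2_norm X g)\<^sup>2 - 2 * Re c"
proof -
  have "((\<lambda>x. (cmod (f x))\<^sup>2 + (cmod (g x))\<^sup>2 + (-2) * Re (f x * cnj (g x))) has_sum
      (ell2_norm X f)\<^sup>2 + (ell2_norm X g)\<^sup>2 + (-2) * Re c) X"
    by (intro has_sum_add has_sum_ell2_norm has_sum_cmult_right has_sum_Re assms)
  moreover have "(cmod (f x))\<^sup>2 + (cmod (g x))\<^sup>2 + (-2) * Re (f x * cnj (g x)) = (cmod (f x - g x))\<^sup>2" for x
    unfolding cmod_power2 by (simp add: power2_eq_square algebra_simps)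
  ultimately show ?thesis
    by (simp add: ell2_norm_sq infsumI)
qed

text \<open>With \<open>s i = \<sigma> i a\<close> and \<open>\<pi> i\<close> the left translation
  by the inverse of \<open>b\<close> this describes \<open>U i (a, b)\<close>; the tensor product
  arguments see only a bijection and a unimodular function.\<close>

locale monomial_unitaries = unit_sequence X \<phi> for X :: "'x set" and \<phi> +
  fixes s :: "nat \<Rightarrow> 'x \<Rightarrow> complex" and \<pi> :: "nat \<Rightarrow> 'x \<Rightarrow> 'x"
  assumes bij: "bij_betw (\<pi> i) X X" and unimodular: "x \<in> X \<Longrightarrow> cmod (s i x) = 1"
begin

definition T :: "nat \<Rightarrow> ('x \<Rightarrow> complex) \<Rightarrow> 'x \<Rightarrow> complex" where
  "T i f = (\<lambda>x. if x \<in> X then s i x * f (\<pi> i x) else 0)"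

lemma T_ell2: "f \<in> ell2 X \<Longrightarrow> T i f \<in> ell2 X" "f \<in> ell2 X \<Longrightarrow> ell2_norm X (T i f) = ell2_norm X f"
  unfolding T_def by (intro ell2_reindex bij unimodular; assumption)+

text \<open>An operator \<open>T i\<close> multiplies by \<open>s i\<close> after substituting \<open>\<pi> i\<close>, so a tensor product of such operators
  is again of this shape on tuples: \<open>act\<close> collects the substitutions and \<open>scalar\<close> the factors.\<close>

definition act :: "nat set \<Rightarrow> 'x list \<Rightarrow> 'x list" where
  "act J xs = map (\<lambda>i. if i \<in> J then \<pi> i (xs ! i) else xs ! i) [0..<length xs]"

definition scalar :: "nat set \<Rightarrow> 'x list \<Rightarrow> complex" where
  "scalar J xs = (\<Prod>i<length xs. if i \<in> J then s i (xs ! i) else 1)"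

definition W :: "nat set \<Rightarrow> nat \<Rightarrow> ('x list \<Rightarrow> complex) \<Rightarrow> 'x list \<Rightarrow> complex" where
  "W J n f = (\<lambda>xs. if xs \<in> tuples X n then scalar J xs * f (act J xs) else 0)"

lemma tuples_nth: "xs \<in> tuples X n \<longleftrightarrow> length xs = n \<and> (\<forall>i<n. xs ! i \<in> X)"
  by (auto simp: tuples_def subset_code(1) all_set_conv_all_nth)

lemma length_act [simp]: "length (act J xs) = length xs"
  by (simp add: act_def)

lemma nth_act [simp]: "i < length xs \<Longrightarrow> act J xs ! i = (if i \<in> J then \<pi> i (xs ! i) else xs ! i)"
  by (simp add: act_def)

lemma \<pi>_closed: "x \<in> X \<Longrightarrow> \<pi> i x \<in> X"
  using bij bij_betwE by blast

lemma act_tuples: "xs \<in> tuples X n \<Longrightarrow> act J xs \<in> tuples X n"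
  by (simp add: tuples_nth \<pi>_closed)

lemma act_bij: "bij_betw (act J) (tuples X n) (tuples X n)"
proof (rule bij_betw_byWitness)
  let ?g = "\<lambda>xs. map (\<lambda>i. if i \<in> J then inv_into X (\<pi> i) (xs ! i) else xs ! i) [0..<length xs]"
  show "\<forall>xs\<in>tuples X n. ?g (act J xs) = xs"
    by (auto simp: tuples_nth bij_betw_inv_into_left[OF bij] intro!: nth_equalityI)
  show "\<forall>xs\<in>tuples X n. act J (?g xs) = xs"
    by (auto simp: tuples_nth bij_betw_inv_into_right[OF bij] intro!: nth_equalityI)
  have "inv_into X (\<pi> i) x \<in> X" if "x \<in> X" for i x
    using bij that by (metis bij_betw_imp_surj_on inv_into_into)
  then show "?g ` tuples X n \<subseteq> tuples X n"
    by (auto simp: tuples_nth)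
qed (auto simp: act_tuples)

lemma scalar_unimodular: "xs \<in> tuples X n \<Longrightarrow> cmod (scalar J xs) = 1"
  unfolding scalar_def prod_norm[symmetric] by (intro prod.neutral) (auto simp: tuples_nth unimodular)

lemma W_ell2:
  assumes "f \<in> ell2 (tuples X n)"
  shows "W J n f \<in> ell2 (tuples X n)" "ell2_norm (tuples X n) (W J n f) = ell2_norm (tuples X n) f"
  unfolding W_def by (intro ell2_reindex act_bij scalar_unimodular assms; assumption)+

lemma W_add: "W J n (\<lambda>xs. f xs + g xs) = (\<lambda>xs. W J n f xs + W J n g xs)"
  by (auto simp: W_def distrib_left)

lemma W_scale: "W J n (\<lambda>xs. c * f xs) = (\<lambda>xs. c * W J n f xs)"
  by (auto simp: W_def)

lemma W_diff: "W J n (\<lambda>xs. f xs - g xs) = (\<lambda>xs. W J n f xs - W J n g xs)"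
  by (auto simp: W_def right_diff_distrib)

text \<open>On each coordinate at most one of the two sets acts, so the scalars of \<open>K\<close>
  are read off unchanged after the substitutions of \<open>J\<close>.\<close>

lemma W_W:
  assumes "J \<inter> K = {}"
  shows "W J n (W K n f) = W (J \<union> K) n f"
proof
  fix xs
  show "W J n (W K n f) xs = W (J \<union> K) n f xs"
  proof (cases "xs \<in> tuples X n")
    case True
    have "act K (act J xs) = act (J \<union> K) xs"
      using assms by (intro nth_equalityI) auto
    moreover have "scalar J xs * scalar K (act J xs) = scalar (J \<union> K) xs"
      unfolding scalar_def length_act prod.distrib[symmetric] using assms by (intro prod.cong) auto
    ultimately show ?thesis
      using True act_tuples[OF True] by (simp add: W_def flip: mult.assoc)
  qed (simp add: W_def)
qed

text \<open>Entries below \<open>n\<close> are read only by \<open>f\<close> and the later ones only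
  by the embedded vectors, so scalars and substitutions split at \<open>n\<close>. The set
  \<open>J\<close> may cross \<open>n\<close>, which is how factors beyond the level of a vector get
  applied.\<close>

lemma W_tensor_embed:
  assumes "n \<le> m"
  shows "W J m (tensor_embed X \<psi> n m f)
    = tensor_embed X (\<lambda>i. if i \<in> J then T i (\<psi> i) else \<psi> i) n m (W J n f)"
proof
  fix xs
  show "W J m (tensor_embed X \<psi> n m f) xs
    = tensor_embed X (\<lambda>i. if i \<in> J then T i (\<psi> i) else \<psi> i) n m (W J n f) xs"
  proof (cases "xs \<in> tuples X m")
    case True
    then have len: "length xs = m" and X: "\<And>i. i < m \<Longrightarrow> xs ! i \<in> X"
      by (auto simp: tuples_nth)
    have "take n xs \<in> tuples X n"
      using assms by (auto simp: tuples_nth len X)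
    moreover have "take n (act J xs) = act J (take n xs)"
      using assms by (intro nth_equalityI) (auto simp: len)
    moreover have "scalar J (take n xs) = (\<Prod>i<n. if i \<in> J then s i (xs ! i) else 1)"
      unfolding scalar_def using assms by (intro prod.cong) (auto simp: len)
    then have "scalar J xs = scalar J (take n xs) * (\<Prod>i=n..<m. if i \<in> J then s i (xs ! i) else 1)"
      using prod.atLeastLessThan_concat[of 0 n m "\<lambda>i. if i \<in> J then s i (xs ! i) else 1"] assms
      by (simp add: scalar_def len atLeast0LessThan)
    moreover have "(\<Prod>i=n..<m. if i \<in> J then s i (xs ! i) else 1) * (\<Prod>i=n..<m. \<psi> i (act J xs ! i))
        = (\<Prod>i=n..<m. (if i \<in> J then T i (\<psi> i) else \<psi> i) (xs ! i))"
      unfolding prod.distrib[symmetric] by (intro prod.cong) (auto simp: len T_def X)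
    ultimately show ?thesis
      using True act_tuples[OF True] by (simp add: W_def tensor_embed_def mult_ac)
  qed (simp add: W_def tensor_embed_def)
qed

lemma W_fixed:
  assumes "J \<inter> {..<n} = {}" "f \<in> ell2 (tuples X n)"
  shows "W J n f = f"
proof
  fix xs
  show "W J n f xs = f xs"
  proof (cases "xs \<in> tuples X n")
    case True
    then have "act J xs = xs"
      using assms(1) by (intro nth_equalityI) (auto simp: tuples_nth)
    moreover have "scalar J xs = 1"
      unfolding scalar_def using True assms(1) by (intro prod.neutral) (auto simp: tuples_nth)
    ultimately show ?thesis
      using True by (simp add: W_def)
  qed (use assms in \<open>auto simp: W_def ell2_outside\<close>)
qed

lemma W_tensor: "W J n (tensor X n \<psi>) = tensor X n (\<lambda>i. if i \<in> J then T i (\<psi> i) else \<psi> i)"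
  unfolding tensor_eq_tensor_embed by (simp add: W_tensor_embed W_fixed unit_ell2_tuples_0)

lemma W_tensor_embed_unit:
  assumes "n \<le> m" "J \<subseteq> {..<n}"
  shows "W J m (tensor_embed X \<phi> n m f) = tensor_embed X \<phi> n m (W J n f)"
proof -
  have "(\<Prod>i=n..<m. (if i \<in> J then T i (\<phi> i) else \<phi> i) (xs ! i)) = (\<Prod>i=n..<m. \<phi> i (xs ! i))" for xs :: "'x list"
    using assms(2) by (intro prod.cong) auto
  then show ?thesis
    unfolding W_tensor_embed[OF assms(1)] by (auto simp: tensor_embed_def)
qed

text \<open>\<open>insert 0\<close> keeps \<open>Max\<close> meaningful for the empty set, whose
  level is therefore 1.\<close>

definition level :: "nat set \<Rightarrow> nat" where
  "level J = Suc (Max (insert 0 J))"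

lemma subset_level: "finite J \<Longrightarrow> J \<subseteq> {..<level J}"
  by (auto simp: level_def less_Suc_eq_le)

text \<open>The partial operator is compatible with the embeddings only on levels which cover \<open>J\<close>, hence the
  passage to a larger level.\<close>

definition R :: "nat set \<Rightarrow> 'x ilim \<Rightarrow> 'x ilim" where
  "R J x = (max (fst x) (level J), W J (max (fst x) (level J)) (lev (max (fst x) (level J)) x))"

lemma fst_R: "fst (R J x) = max (fst x) (level J)"
  by (simp add: R_def)

lemma R_carrier: "x \<in> C \<Longrightarrow> R J x \<in> C"
  using W_ell2(1)[OF lev_ell2] by (auto simp: R_def ilim_carrier_def[of X])

lemma lev_R:
  assumes "finite J" "fst x \<le> m" "level J \<le> m"
  shows "lev m (R J x) = W J m (lev m x)"
proof -
  define l where "l = max (fst x) (level J)"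
  have l: "l \<le> m" "J \<subseteq> {..<l}" "fst x \<le> l"
    using assms subset_level[OF assms(1)] by (auto simp: l_def)
  have "lev m (R J x) = tensor_embed X \<phi> l m (W J l (lev l x))"
    by (simp add: R_def lev_def l_def)
  also have "\<dots> = W J m (tensor_embed X \<phi> l m (lev l x))"
    by (simp add: W_tensor_embed_unit l)
  also have "tensor_embed X \<phi> l m (lev l x) = lev m x"
    using l by (simp add: lev_def tensor_embed_tensor_embed)
  finally show ?thesis .
qed

lemma R_dist:
  assumes "finite J" "x \<in> C" "y \<in> C"
  shows "d (R J x) (R J y) = d x y"
proof -
  define m where "m = max (level J) (max (fst x) (fst y))"
  have m: "fst x \<le> m" "fst y \<le> m" "level J \<le> m"
    by (auto simp: m_def)
  have "d (R J x) (R J y) = ell2_norm (tuples X m) (W J m (\<lambda>xs. lev m x xs - lev m y xs))"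
    by (subst dist_lev[where m = m]) (simp_all add: R_carrier assms m fst_R lev_R W_diff)
  also have "\<dots> = d x y"
    by (simp add: W_ell2 ell2_diff lev_ell2 assms m dist_lev[where m = m])
  finally show ?thesis .
qed

lemma dist_eq_0I:
  assumes "x \<in> C" "y \<in> C" "fst x \<le> m" "fst y \<le> m" "lev m x = lev m y"
  shows "d x y = 0"
  using assms by (simp add: dist_lev[where m = m])

lemma R_isometry: assumes "finite J" shows "ilim_isometry (R J)"
  unfolding ilim_isometry_def
proof (intro conjI ballI allI)
  show "N (R J x) = N x" if "x \<in> C" for x
    using that assms
    by (simp add: norm_lev[where m = "max (fst x) (level J)", symmetric] R_carrier fst_R lev_R W_ell2 lev_ell2)
  show "d (R J (add x y)) (add (R J x) (R J y)) = 0" if "x \<in> C" "y \<in> C" for x y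
  proof -
    define m where "m = max (level J) (max (fst x) (fst y))"
    have "fst x \<le> m" "fst y \<le> m" "level J \<le> m"
      by (auto simp: m_def)
    with that assms show ?thesis
      by (intro dist_eq_0I[where m = m])
        (simp_all add: R_carrier carrier_intros fst_R fst_add lev_R lev_add W_add)
  qed
  show "d (R J (ilim_scale c x)) (ilim_scale c (R J x)) = 0" if "x \<in> C" for x c
    using that assms
    by (intro dist_eq_0I[where m = "max (level J) (fst x)"])
      (simp_all add: R_carrier carrier_intros fst_R fst_scale lev_R lev_scale W_scale)
qed (auto simp: R_carrier R_dist assms)

lemma R_R:
  assumes "finite J" "finite K" "J \<inter> K = {}" "x \<in> C"
  shows "d (R (J \<union> K) x) (R J (R K x)) = 0"
proof -
  define m where "m = max (max (level J) (level K)) (max (level (J \<union> K)) (fst x))"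
  have "level J \<le> m" "level K \<le> m" "level (J \<union> K) \<le> m" "fst x \<le> m"
    by (auto simp: m_def)
  with assms show ?thesis
    by (intro dist_eq_0I[where m = m]) (simp_all add: R_carrier fst_R lev_R W_W)
qed

section \<open>Matrix coefficients and the displacement of a vector\<close>

definition coef :: "nat \<Rightarrow> complex" where
  "coef i = (\<Sum>\<^sub>\<infinity>x\<in>X. T i (\<phi> i) x * cnj (\<phi> i x))"

lemma has_sum_coef: "((\<lambda>x. T i (\<phi> i) x * cnj (\<phi> i x)) has_sum coef i) X"
  unfolding coef_def by (intro has_sum_inner_ell2 T_ell2 unit_ell2)

lemma coef_le_1: "cmod (coef i) \<le> 1"
  using has_sum_inner_ell2(2)[OF T_ell2(1)[OF unit_ell2] unit_ell2, of i i]
  by (simp add: coef_def T_ell2 unit_ell2 unit_norm)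

lemma T_unit_dist_sq: "(ell2_norm X (\<lambda>x. T i (\<phi> i) x - \<phi> i x))\<^sup>2 = 2 * (1 - Re (coef i))"
  using ell2_norm_diff_sq[OF T_ell2(1)[OF unit_ell2] unit_ell2 has_sum_coef]
  by (simp add: T_ell2 unit_ell2 unit_norm)

text \<open>Beyond the level of \<open>x\<close> both vectors extend the same \<open>f\<close>,
  hence their inner product factorizes into \<open>(N x)\<^sup>2\<close> and one factor per new
  coordinate: \<open>coef i\<close> for \<open>i \<in> K\<close> and 1 elsewhere. Both vectors have
  norm \<open>N x\<close>, so expanding the squared norm of the difference gives the
  formula.\<close>

lemma dist_R_self:
  assumes "finite K" "x \<in> C" "K \<inter> {..<fst x} = {}"
  shows "(d (R K x) x)\<^sup>2 = 2 * (N x)\<^sup>2 * (1 - Re (\<Prod>i\<in>K. coef i))"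
proof -
  obtain n f where x: "x = (n, f)" by force
  have f: "f \<in> ell2 (tuples X n)"
    using assms(2) by (simp add: x ilim_carrier_def)
  define m where "m = max n (level K)"
  have m: "n \<le> m" "level K \<le> m" "K \<subseteq> {n..<m}"
    using subset_level[OF assms(1)] assms(3) by (force simp: m_def x)+
  let ?\<psi> = "\<lambda>i. if i \<in> K then T i (\<phi> i) else \<phi> i"
  let ?F = "tensor_embed X ?\<psi> n m f" and ?G = "tensor_embed X \<phi> n m f"
  have WF: "W K m ?G = ?F"
    using assms(3) by (simp add: W_tensor_embed m W_fixed f x)
  have h: "((\<lambda>xs. (f (take n xs) * cnj (f (take n xs))) * (\<Prod>i=n..<m. ?\<psi> i (xs ! i) * cnj (\<phi> i (xs ! i))))
      has_sum of_real ((N x)\<^sup>2) * (\<Prod>i=n..<m. if i \<in> K then coef i else 1)) (tuples X m)"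
  proof (rule has_sum_tuples_prod[OF m(1)])
    show "((\<lambda>xs. f xs * cnj (f xs)) has_sum of_real ((N x)\<^sup>2)) (tuples X n)"
      unfolding complex_norm_square[symmetric] has_sum_of_real_iff
      using has_sum_ell2_norm[OF f] by (simp add: x ilim_norm_def)
    show "((\<lambda>x. ?\<psi> i x * cnj (\<phi> i x)) has_sum (if i \<in> K then coef i else 1)) X" for i
    proof (cases "i \<in> K")
      case False
      have "((\<lambda>x. \<phi> i x * cnj (\<phi> i x)) has_sum of_real ((ell2_norm X (\<phi> i))\<^sup>2)) X"
        unfolding complex_norm_square[symmetric] has_sum_of_real_iff
        by (rule has_sum_ell2_norm[OF unit_ell2])
      then show ?thesis
        using False by (simp add: unit_norm)
    qed (simp add: has_sum_coef)
  qed
  have eq: "(\<Prod>i=n..<m. if i \<in> K then coef i else 1) = (\<Prod>i\<in>K. coef i)"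
    using m(3) by (intro prod.mono_neutral_cong_right) auto
  have h: "((\<lambda>xs. ?F xs * cnj (?G xs)) has_sum of_real ((N x)\<^sup>2) * (\<Prod>i\<in>K. coef i)) (tuples X m)"
    by (rule has_sum_cong[THEN iffD1, OF _ h[unfolded eq]]) (simp add: tensor_embed_def prod.distrib mult_ac)
  have G: "?G \<in> ell2 (tuples X m)" "ell2_norm (tuples X m) ?G = N x"
    using lev_ell2[OF assms(2)] norm_lev[OF assms(2)] m by (simp_all add: x lev_def)
  then have F: "?F \<in> ell2 (tuples X m)" "ell2_norm (tuples X m) ?F = N x"
    using W_ell2 by (simp_all add: WF[symmetric])
  have "d (R K x) x = ell2_norm (tuples X m) (\<lambda>xs. ?F xs - ?G xs)"
  proof -
    have fst: "fst x \<le> m" "fst (R K x) \<le> m"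
      using m by (auto simp: fst_R x)
    have "lev m x = ?G"
      by (simp add: x lev_def)
    then show ?thesis
      using fst m(2) by (simp add: dist_lev[where m = m] R_carrier assms lev_R WF)
  qed
  then show ?thesis
    using ell2_norm_diff_sq[OF F(1) G(1) h] by (simp add: F G algebra_simps)
qed

text \<open>All \<open>coef i\<close> lie in the closed unit disc, so replacing the factors of the
  product by 1 one after the other costs at most the sum of the single errors.\<close>

lemma dist_R_self_le:
  assumes "finite K" "x \<in> C" "K \<inter> {..<fst x} = {}"
  shows "(d (R K x) x)\<^sup>2 \<le> 2 * (N x)\<^sup>2 * (\<Sum>i\<in>K. cmod (1 - coef i))"
proof -
  have "1 - Re (\<Prod>i\<in>K. coef i) \<le> cmod ((\<Prod>i\<in>K. 1) - (\<Prod>i\<in>K. coef i))"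
    using complex_Re_le_cmod[of "1 - (\<Prod>i\<in>K. coef i)"] by simp
  also have "\<dots> \<le> (\<Sum>i\<in>K. cmod (1 - coef i))"
    by (rule norm_prod_diff) (auto simp: coef_le_1)
  finally show ?thesis
    unfolding dist_R_self[OF assms] by (intro mult_left_mono) auto
qed

text \<open>The common factors in \<open>{..<M}\<close> act isometrically and cancel, leaving the
  displacement caused by the new ones.\<close>

lemma dist_R_R:
  assumes "finite J" "{..<M} \<subseteq> J" "x \<in> C"
  shows "d (R J x) (R {..<M} x) = d (R (J - {..<M}) x) x"
proof -
  have J: "{..<M} \<union> (J - {..<M}) = J"
    using assms(2) by blast
  have "d (R J x) (R {..<M} (R (J - {..<M}) x)) = 0"
    using R_R[of "{..<M}" "J - {..<M}" x] assms unfolding J by auto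
  then have "d (R J x) (R {..<M} x) = d (R {..<M} (R (J - {..<M}) x)) (R {..<M} x)"
    using dist_diff_le[of "R J x" "R {..<M} x" "R {..<M} (R (J - {..<M}) x)" "R {..<M} x"]
    by (simp add: R_carrier assms dist_self)
  then show ?thesis
    by (simp add: R_dist R_carrier assms)
qed

section \<open>Identification of the partial operators\<close>

definition partial_spec where
  "partial_spec J S \<longleftrightarrow> itp_bounded_op X \<phi> S \<and>
     (\<forall>k \<psi>. J \<subseteq> {..<k} \<and> (\<forall>i<k. \<psi> i \<in> ell2 X) \<longrightarrow>
        S (itp_elem X \<phi> k \<psi>) = itp_elem X \<phi> k (\<lambda>i. if i \<in> J then T i (\<psi> i) else \<psi> i))"

lemma lift_R:
  assumes "finite J"
  shows "itp_bounded_op X \<phi> (ilim_lift (\<lambda>_. R J))"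
    "p \<in> CS \<Longrightarrow> ilim_lift (\<lambda>_. R J) (cls p) = cls (\<lambda>k. R J (p k))"
    "p \<in> CS \<Longrightarrow> (\<lambda>k. R J (p k)) \<in> CS"
  by (rule ilim_lift_bounded_op ilim_lift_cls lift_CS[where Q = "\<lambda>_. R J"];
      simp add: R_isometry CS_const R_carrier assms)+

lemma partial_spec_lift:
  assumes "finite J"
  shows "partial_spec J (ilim_lift (\<lambda>_. R J))"
  unfolding partial_spec_def
proof (intro conjI allI impI lift_R(1)[OF assms], elim conjE)
  fix k \<psi> assume J: "J \<subseteq> {..<k}" and \<psi>: "\<forall>i<k. \<psi> i \<in> ell2 X"
  \<comment> \<open>\<open>{..<k}\<close> already covers \<open>J\<close>; the maximum matters only
    for empty \<open>J\<close>, where \<open>level J\<close> is 1 but \<open>k\<close> may be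
    0.\<close>
  let ?\<psi> = "\<lambda>i. if i \<in> J then T i (\<psi> i) else \<psi> i" and ?m = "max k (level J)"
  let ?x = "(k, tensor X k \<psi>)" and ?y = "(k, tensor X k ?\<psi>)"
  have C: "?x \<in> C" "?y \<in> C"
    using \<psi> by (auto intro!: tensor_carrier T_ell2)
  have "W J ?m (lev ?m ?x) = lev ?m ?y"
    using J by (simp add: lev_def W_tensor_embed_unit W_tensor)
  then have "d (R J ?x) ?y = 0"
    by (intro dist_eq_0I[where m = ?m]) (simp_all add: R_carrier C fst_R lev_R assms)
  then show "ilim_lift (\<lambda>_. R J) (itp_elem X \<phi> k \<psi>) = itp_elem X \<phi> k ?\<psi>"
    by (simp add: itp_elem_eq lift_R assms CS_const C cls_const_eq R_carrier)
qed

text \<open>Point masses on tuples are elementary tensors, so every finitely supported function at a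
  level is a linear combination of such tensors.\<close>

lemma tensor_delta:
  assumes "ys \<in> tuples X m"
  shows "tensor X m (\<lambda>i x. if x = ys ! i then 1 else 0) = (\<lambda>xs. if xs = ys then 1 else 0)"
proof
  fix xs
  show "tensor X m (\<lambda>i x. if x = ys ! i then 1 else 0) xs = (if xs = ys then 1 else 0)"
  proof (cases "xs \<in> tuples X m \<and> xs \<noteq> ys")
    case True
    then obtain i where "i < m" "xs ! i \<noteq> ys ! i"
      using assms by (metis nth_equalityI tuples_nth)
    then have "(\<Prod>i<m. if xs ! i = ys ! i then 1 else 0 :: complex) = 0"
      by (intro prod_zero) auto
    then show ?thesis
      using True by (simp add: tensor_def)
  next
    case False
    then show ?thesis
      using assms by (cases "xs = ys") (simp_all add: tensor_def)
  qed
qed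

lemma delta_ell2: "x \<in> X \<Longrightarrow> (\<lambda>y. if y = x then 1 else 0) \<in> ell2 X"
  using ell2_finite_support[of "{x}" X "\<lambda>_. 1"] by simp

text \<open>Density in two stages: the inductive limit is dense in the completion, and at a level
  covering \<open>J\<close> the finitely supported functions are dense, where linearity and the
  prescribed values decide. Boundedness carries the agreement over to the closure.\<close>

lemma partial_spec_unique:
  assumes "finite J" and S: "partial_spec J S" "partial_spec J S'" and u: "u \<in> itp X \<phi>"
  shows "S u = S' u"
proof -
  have bounded: "itp_bounded_op X \<phi> S" "itp_bounded_op X \<phi> S'"
    using S by (auto simp: partial_spec_def)
  have elem: "S (itp_elem X \<phi> m \<psi>) = S' (itp_elem X \<phi> m \<psi>)"
    if "J \<subseteq> {..<m}" "\<And>i. i < m \<Longrightarrow> \<psi> i \<in> ell2 X" for m \<psi>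
    using that S by (simp add: partial_spec_def)
  have lin: "S (itp_add X \<phi> v w) = S' (itp_add X \<phi> v w)"
    if "S v = S' v" "S w = S' w" "v \<in> itp X \<phi>" "w \<in> itp X \<phi>" for v w
    using that bounded by (simp add: itp_bounded_op_def)
  have scl: "S (itp_scale X \<phi> c v) = S' (itp_scale X \<phi> c v)"
    if "S v = S' v" "v \<in> itp X \<phi>" for c v
    using that bounded by (simp add: itp_bounded_op_def)
  have fin: "S (cls (\<lambda>_. (m, \<lambda>xs. if xs \<in> F then f xs else 0))) = S' (cls (\<lambda>_. (m, \<lambda>xs. if xs \<in> F then f xs else 0)))"
    if "finite F" "F \<subseteq> tuples X m" "J \<subseteq> {..<m}" for F m f
    using that(1,2)
  proof (induction F)
    case empty
    \<comment> \<open>The zero vector is reached as 0 times an elementary vector, because agreement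
      is known only on elementary vectors and what linearity makes of them.\<close>
    have "S (itp_scale X \<phi> 0 (itp_elem X \<phi> m \<phi>)) = S' (itp_scale X \<phi> 0 (itp_elem X \<phi> m \<phi>))"
      using that(3) by (intro scl elem) (auto simp: unit_ell2 itp_elem_eq intro!: cls_itp CS_const tensor_carrier)
    moreover have "itp_scale X \<phi> 0 (itp_elem X \<phi> m \<phi>) = cls (\<lambda>_. (m, \<lambda>xs. 0))"
      by (simp add: itp_elem_eq itp_scale_cls CS_const tensor_carrier unit_ell2 ilim_scale_def)
    ultimately show ?case by simp
  next
    case (insert ys F)
    let ?\<delta> = "\<lambda>i x. if x = ys ! i then 1 else 0"
    let ?g = "\<lambda>xs. if xs \<in> F then f xs else 0"
    have ys: "ys \<in> tuples X m" and F: "F \<subseteq> tuples X m"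
      using insert.prems by auto
    have C: "(m, tensor X m ?\<delta>) \<in> C" "(m, ?g) \<in> C"
      using ys F insert.hyps(1)
      by (auto simp: ilim_carrier_def tuples_nth intro!: tensor_ell2 delta_ell2 ell2_finite_support)
    then have g: "tensor_embed X \<phi> m m ?g = ?g"
      by (simp add: ilim_carrier_def tensor_embed_self)
    have \<delta>: "tensor_embed X \<phi> m m (\<lambda>xs. f ys * (if xs = ys then 1 else 0)) = (\<lambda>xs. f ys * (if xs = ys then 1 else 0))"
      using C(1) unfolding tensor_delta[OF ys] tensor_embed_scale by (simp add: ilim_carrier_def tensor_embed_self)
    have "S (itp_add X \<phi> (itp_scale X \<phi> (f ys) (itp_elem X \<phi> m ?\<delta>)) (cls (\<lambda>_. (m, ?g))))
      = S' (itp_add X \<phi> (itp_scale X \<phi> (f ys) (itp_elem X \<phi> m ?\<delta>)) (cls (\<lambda>_. (m, ?g))))"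
    proof (intro lin scl elem insert.IH F that(3))
      show "?\<delta> i \<in> ell2 X" if "i < m" for i
        using ys that by (intro delta_ell2) (simp add: tuples_nth)
    qed (auto simp: C itp_elem_eq itp_scale_cls CS_const CS_scale intro!: cls_itp)
    also have "itp_add X \<phi> (itp_scale X \<phi> (f ys) (itp_elem X \<phi> m ?\<delta>)) (cls (\<lambda>_. (m, ?g)))
      = cls (\<lambda>_. (m, \<lambda>xs. if xs \<in> insert ys F then f xs else 0))"
    proof -
      have "add (ilim_scale (f ys) (m, tensor X m ?\<delta>)) (m, ?g) = (m, \<lambda>xs. if xs \<in> insert ys F then f xs else 0)"
        using insert.hyps(2) by (auto simp: ilim_add_def ilim_scale_def Let_def g \<delta> tensor_delta[OF ys])
      then show ?thesis
        by (simp add: itp_elem_eq itp_scale_cls itp_add_cls CS_const CS_scale C ilim_scale_carrier)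
    qed
    finally show ?case .
  qed
  obtain K where K: "0 < K" "\<And>u v. u \<in> itp X \<phi> \<Longrightarrow> v \<in> itp X \<phi> \<Longrightarrow> itp_dist X \<phi> (S u) (S v) \<le> K * itp_dist X \<phi> u v"
    using itp_bounded_op_dist[OF bounded(1)] by blast
  obtain K' where K': "0 < K'" "\<And>u v. u \<in> itp X \<phi> \<Longrightarrow> v \<in> itp X \<phi> \<Longrightarrow> itp_dist X \<phi> (S' u) (S' v) \<le> K' * itp_dist X \<phi> u v"
    using itp_bounded_op_dist[OF bounded(2)] by blast
  have closed: "S v \<in> itp X \<phi>" "S' v \<in> itp X \<phi>" if "v \<in> itp X \<phi>" for v
    using bounded that by (auto simp: itp_bounded_op_def)
  obtain p where p: "p \<in> CS" "u = cls p"
    using u by (rule itpE)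
  have "itp_dist X \<phi> (S u) (S' u) \<le> 0 + e" if "0 < e" for e
  proof -
    \<comment> \<open>Two errors of size \<open>e'\<close> will occur, one from leaving the
      completion and one from truncating the support; their sum is magnified by \<open>K\<close> and
      by \<open>K'\<close>, which together give \<open>e\<close>.\<close>
    define e' where "e' = e / (K + K') / 2"
    have e': "0 < e'"
      using K(1) K'(1) that by (simp add: e'_def)
    obtain M where "itp_dist X \<phi> u (cls (\<lambda>_. p M)) < e'"
      using cls_const_dense[OF p(1) e'] p(2) by blast
    moreover obtain n f where pM: "p M = (n, f)" by force
    \<comment> \<open>The level is raised until it covers \<open>J\<close>, as the specification is
      silent about smaller ones.\<close>
    define m where "m = max n (level J)"
    have m: "n \<le> m" "J \<subseteq> {..<m}"
      using subset_level[OF assms(1)] by (auto simp: m_def)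
    let ?h = "lev m (n, f)"
    have h: "?h \<in> ell2 (tuples X m)" and nf: "(n, f) \<in> C"
      using CS_carrier[OF p(1), of M] m by (simp_all add: pM lev_ell2)
    obtain F where F: "finite F" "F \<subseteq> tuples X m"
      "ell2_norm (tuples X m) (\<lambda>xs. ?h xs - (if xs \<in> F then ?h xs else 0)) < e'"
      using ell2_finite_approx[OF h e'] by blast
    let ?v = "(m, \<lambda>xs. if xs \<in> F then ?h xs else 0)"
    have v: "?v \<in> C"
      using F by (simp add: ilim_carrier_def ell2_finite_support)
    then have "lev m ?v = (\<lambda>xs. if xs \<in> F then ?h xs else 0)"
      by (simp add: lev_def ilim_carrier_def tensor_embed_self)
    then have "d (p M) ?v < e'"
      using F(3) m nf v by (subst dist_lev[where m = m]) (simp_all add: pM)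
    ultimately have close: "itp_dist X \<phi> u (cls (\<lambda>_. ?v)) < 2 * e'"
      using itp_dist_triangle[OF u cls_itp[OF CS_const] cls_itp[OF CS_const], of "p M" ?v] v nf
      by (simp add: itp_dist_const pM)
    have v': "cls (\<lambda>_. ?v) \<in> itp X \<phi>"
      by (intro cls_itp CS_const v)
    have "itp_dist X \<phi> (S u) (S' u) \<le> itp_dist X \<phi> (S u) (S (cls (\<lambda>_. ?v))) + itp_dist X \<phi> (S' (cls (\<lambda>_. ?v))) (S' u)"
      using fin[OF F(1,2) m(2), of ?h] itp_dist_triangle[OF closed(1)[OF u] closed(1)[OF v'] closed(2)[OF u]] by simp
    also have "\<dots> \<le> (K + K') * itp_dist X \<phi> u (cls (\<lambda>_. ?v))"
      using K(2)[OF u v'] K'(2)[OF v' u] itp_dist_commute[OF u v'] by (simp add: distrib_right)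
    also have "\<dots> \<le> (K + K') * (2 * e')"
      using close K(1) K'(1) by (intro mult_left_mono) auto
    also have "\<dots> = 0 + e"
      using K(1) K'(1) by (simp add: e'_def field_simps)
    finally show ?thesis .
  qed
  then have "itp_dist X \<phi> (S u) (S' u) \<le> 0"
    by (rule field_le_epsilon)
  then show ?thesis
    using itp_dist_nonneg[OF closed(1)[OF u] closed(2)[OF u]]
    by (intro itp_dist_eq_0 closed u) simp
qed

lemma itp_partial_op_eq:
  assumes "finite J" "u \<in> itp X \<phi>"
  shows "itp_partial_op X \<phi> T J u = ilim_lift (\<lambda>_. R J) u"
proof -
  have eq: "itp_partial_op X \<phi> T J = (SOME S. partial_spec J S)"
    unfolding itp_partial_op_def partial_spec_def ..
  have "partial_spec J (SOME S. partial_spec J S)"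
    by (rule someI[of "partial_spec J", OF partial_spec_lift[OF assms(1)]])
  then show ?thesis
    unfolding eq by (rule partial_spec_unique[OF assms(1) _ partial_spec_lift[OF assms(1)] assms(2)])
qed

section \<open>Existence of the tensor product in terms of the coefficients\<close>

theorem itp_op_exists_imp_coef:
  assumes "itp_op_exists X \<phi> T"
  shows "(\<lambda>i. Re (coef i)) \<longlonglongrightarrow> 1"
proof -
  \<comment> \<open>At level 0 \<open>dist_R_self\<close> applies to every singleton; the class of
    this element is the vector with all factors \<open>\<phi> i\<close>.\<close>
  let ?x = "(0, tensor X 0 \<phi>)"
  have x: "?x \<in> C" by (intro tensor_carrier) simp
  have Nx: "N ?x = 1"
    using tensor_ell2(2)[of 0 \<phi> X] by (simp add: ilim_norm_def)
  let ?u = "cls (\<lambda>_. ?x)"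
  have u: "?u \<in> itp X \<phi>" by (intro cls_itp CS_const x)
  obtain S where S: "itp_bounded_op X \<phi> S"
    "((\<lambda>J. itp_dist X \<phi> (itp_partial_op X \<phi> T J ?u) (S ?u)) \<longlongrightarrow> 0) (finite_subsets_at_top UNIV)"
    using assms u unfolding itp_op_exists_def by blast
  have Su: "S ?u \<in> itp X \<phi>"
    using S(1) u by (simp add: itp_bounded_op_def)
  have Ru: "itp_partial_op X \<phi> T J ?u = cls (\<lambda>_. R J ?x)" if "finite J" for J
    using that by (simp add: itp_partial_op_eq u lift_R CS_const x)
  have Ritp: "cls (\<lambda>_. R J ?x) \<in> itp X \<phi>" for J
    by (intro cls_itp CS_const R_carrier x)
  have "(\<lambda>i. d (R {i} ?x) ?x) \<longlonglongrightarrow> 0"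
  proof (rule LIMSEQ_I)
    fix e :: real assume "0 < e"
    then have "eventually (\<lambda>J. dist (itp_dist X \<phi> (itp_partial_op X \<phi> T J ?u) (S ?u)) 0 < e / 2) (finite_subsets_at_top UNIV)"
      using tendstoD[OF S(2), of "e / 2"] by simp
    then obtain J0 where J0: "finite J0" "\<forall>J. finite J \<and> J0 \<subseteq> J \<and> J \<subseteq> UNIV \<longrightarrow>
        dist (itp_dist X \<phi> (itp_partial_op X \<phi> T J ?u) (S ?u)) 0 < e / 2"
      unfolding eventually_finite_subsets_at_top by (elim exE conjE) (rule that)
    have close: "itp_dist X \<phi> (cls (\<lambda>_. R J ?x)) (S ?u) < e / 2" if "finite J" "J0 \<subseteq> J" for J
      using J0(2)[rule_format, of J] that unfolding Ru[OF that(1)] dist_real_def by simp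
    have "norm (d (R {i} ?x) ?x - 0) < e" if "level J0 \<le> i" for i
    proof -
      have J: "J0 \<subseteq> {..<i}"
        using subset_level[OF J0(1)] that by auto
      \<comment> \<open>Neighbouring initial segments differ by the factor \<open>i\<close> alone.
        Both partial products are within \<open>e / 2\<close> of the limit, so this factor moves the
        vector by less than \<open>e\<close>.\<close>
      have eq: "{..<Suc i} - {..<i} = {i}" by auto
      have "d (R {i} ?x) ?x = d (R {..<Suc i} ?x) (R {..<i} ?x)"
        by (subst dist_R_R) (auto simp: x eq)
      also have "\<dots> \<le> itp_dist X \<phi> (cls (\<lambda>_. R {..<Suc i} ?x)) (S ?u) + itp_dist X \<phi> (S ?u) (cls (\<lambda>_. R {..<i} ?x))"
        using itp_dist_triangle[OF Ritp Su Ritp, of "{..<Suc i}" "{..<i}"]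
        by (simp add: itp_dist_const R_carrier x)
      also have "\<dots> < e"
        using close[of "{..<Suc i}"] close[of "{..<i}"] J itp_dist_commute[OF Su Ritp, of "{..<i}"]
        by (force simp: lessThan_Suc)
      finally show ?thesis
        by (simp add: dist_nonneg)
    qed
    then show "\<exists>M. \<forall>i\<ge>M. norm (d (R {i} ?x) ?x - 0) < e"
      by blast
  qed
  then have "(\<lambda>i. 1 - (d (R {i} ?x) ?x)\<^sup>2 / 2) \<longlonglongrightarrow> 1 - 0\<^sup>2 / 2"
    by (intro tendsto_intros) auto
  moreover have "1 - (d (R {i} ?x) ?x)\<^sup>2 / 2 = Re (coef i)" for i
    by (subst dist_R_self) (auto simp: x Nx field_simps)
  ultimately show ?thesis by simp
qed

context
  assumes summable_coef: "summable (\<lambda>i. cmod (1 - coef i))"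
begin

lemma dist_R_tail:
  assumes "x \<in> C" "0 < e"
  obtains M where "\<And>J. finite J \<Longrightarrow> {..<M} \<subseteq> J \<Longrightarrow> d (R J x) (R {..<M} x) < e"
proof -
  \<comment> \<open>Adding 1 avoids a zero denominator and makes the final estimate strict.\<close>
  define e' where "e' = e\<^sup>2 / (2 * (N x)\<^sup>2 + 1)"
  have "0 < e'"
    using assms(2) by (simp add: e'_def add_nonneg_pos)
  then obtain M0 where M0: "\<And>m n. M0 \<le> m \<Longrightarrow> norm (\<Sum>i=m..<n. cmod (1 - coef i)) < e'"
    using summable_coef unfolding summable_Cauchy by blast
  \<comment> \<open>\<open>M\<close> is at least the level of \<open>x\<close>, so that the
    remaining factors meet only coordinates filled with \<open>\<phi> i\<close>; these factors lie
    in \<open>{M..<level J}\<close>, a block of the convergent series.\<close>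
  define M where "M = max M0 (fst x)"
  have "d (R J x) (R {..<M} x) < e" if J: "finite J" "{..<M} \<subseteq> J" for J
  proof -
    let ?K = "J - {..<M}"
    have "(\<Sum>i\<in>?K. cmod (1 - coef i)) \<le> (\<Sum>i=M..<level J. cmod (1 - coef i))"
      using subset_level[OF J(1)] by (intro sum_mono2) auto
    also have "\<dots> < e'"
      using M0[of M "level J"] by (simp add: M_def sum_nonneg)
    finally have less: "(\<Sum>i\<in>?K. cmod (1 - coef i)) < e'" .
    have "(d (R ?K x) x)\<^sup>2 \<le> 2 * (N x)\<^sup>2 * (\<Sum>i\<in>?K. cmod (1 - coef i))"
      using J by (intro dist_R_self_le assms) (auto simp: M_def)
    also have "\<dots> \<le> 2 * (N x)\<^sup>2 * e'"
      using less by (intro mult_left_mono) auto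
    also have "\<dots> < (2 * (N x)\<^sup>2 + 1) * e'"
      using \<open>0 < e'\<close> by (simp add: distrib_right)
    also have "\<dots> = e\<^sup>2"
      unfolding e'_def by (simp add: add_nonneg_eq_0_iff)
    finally have "d (R ?K x) x < e"
      using assms(2) power_less_imp_less_base by (metis less_eq_real_def)
    then show ?thesis
      by (simp add: dist_R_R J assms)
  qed
  then show ?thesis
    using that by blast
qed

lemma R_initial_CS:
  assumes "x \<in> C"
  shows "(\<lambda>k. R {..<k} x) \<in> CS"
proof (rule CS_I)
  fix e :: real assume "0 < e"
  then have "0 < e / 2" by simp
  then obtain M where M: "\<And>J. finite J \<Longrightarrow> {..<M} \<subseteq> J \<Longrightarrow> d (R J x) (R {..<M} x) < e / 2"
    using dist_R_tail[OF assms] by blast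
  have "d (R {..<m} x) (R {..<n} x) < e" if "M \<le> m" "M \<le> n" for m n
    using M[of "{..<m}"] M[of "{..<n}"] that dist_triangle[of "R {..<m} x" "R {..<M} x" "R {..<n} x"]
      dist_commute[of "R {..<M} x" "R {..<n} x"]
    by (simp add: R_carrier assms)
  then show "\<exists>M. \<forall>m\<ge>M. \<forall>n\<ge>M. d (R {..<m} x) (R {..<n} x) < e"
    by blast
qed (simp add: R_carrier assms)

theorem summable_imp_itp_op_exists: "itp_op_exists X \<phi> T"
  unfolding itp_op_exists_def
proof (intro exI conjI ballI)
  \<comment> \<open>Initial segments are cofinal among the finite sets, so the limit operator can be
    built along them; \<open>ilim_lift\<close> takes the limit diagonally.\<close>
  let ?S = "ilim_lift (\<lambda>k. R {..<k})"
  show "itp_bounded_op X \<phi> ?S"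
    by (intro ilim_lift_bounded_op R_isometry R_initial_CS) auto
  fix u assume u: "u \<in> itp X \<phi>"
  then obtain p where p: "p \<in> CS" "u = cls p"
    by (rule itpE)
  have Su: "?S u = cls (\<lambda>k. R {..<k} (p k))" "(\<lambda>k. R {..<k} (p k)) \<in> CS"
    unfolding p(2)
    by (rule ilim_lift_cls[where Q = "\<lambda>k. R {..<k}"] lift_CS[where Q = "\<lambda>k. R {..<k}"];
        simp add: R_isometry R_initial_CS p(1))+
  show "((\<lambda>J. itp_dist X \<phi> (itp_partial_op X \<phi> T J u) (?S u)) \<longlongrightarrow> 0) (finite_subsets_at_top UNIV)"
  proof (rule tendstoI)
    fix e :: real assume "0 < e"
    \<comment> \<open>Four steps of size \<open>e / 5\<close> lead from one sequence to the other;
      the limit keeps only a weak inequality, and the fifth part restores strictness.\<close>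
    then have e: "0 < e / 5" by simp
    obtain L where L: "\<And>k l. L \<le> k \<Longrightarrow> L \<le> l \<Longrightarrow> d (p k) (p l) < e / 5"
      using CS_dist[OF p(1) e] by blast
    let ?x = "p L"
    have C: "p k \<in> C" for k
      by (simp add: CS_carrier p)
    obtain M where M: "\<And>J. finite J \<Longrightarrow> {..<M} \<subseteq> J \<Longrightarrow> d (R J ?x) (R {..<M} ?x) < e / 5"
      using dist_R_tail[OF C e] by blast
    have RJ: "itp_partial_op X \<phi> T J u = cls (\<lambda>k. R J (p k))" "(\<lambda>k. R J (p k)) \<in> CS" if "finite J" for J
      using itp_partial_op_eq[OF that u] lift_R(2,3)[OF that p(1)] by (simp_all add: p(2))
    have "itp_dist X \<phi> (itp_partial_op X \<phi> T J u) (?S u) < e" if J: "finite J" "{..<M} \<subseteq> J" for J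
    proof -
      have "d (R J (p k)) (R {..<k} (p k)) \<le> 4 * e / 5" if k: "max L M \<le> k" for k
      proof -
        have "d (R J (p k)) (R {..<k} (p k)) \<le> d (R J (p k)) (R J ?x) + d (R J ?x) (R {..<M} ?x)
            + d (R {..<M} ?x) (R {..<k} ?x) + d (R {..<k} ?x) (R {..<k} (p k))"
          using dist_triangle[of "R J (p k)" "R J ?x" "R {..<k} (p k)"]
            dist_triangle[of "R J ?x" "R {..<M} ?x" "R {..<k} (p k)"]
            dist_triangle[of "R {..<M} ?x" "R {..<k} ?x" "R {..<k} (p k)"]
          by (simp add: R_carrier C)
        also have "d (R {..<M} ?x) (R {..<k} ?x) = d (R {..<k} ?x) (R {..<M} ?x)"
          by (simp add: dist_commute R_carrier C)
        finally show ?thesis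
          using L[of k L] L[of L k] M[of J] M[of "{..<k}"] k J by (simp add: R_dist C)
      qed
      then have "itp_dist X \<phi> (itp_partial_op X \<phi> T J u) (?S u) \<le> 4 * e / 5"
        unfolding RJ(1)[OF J(1)] Su(1) by (intro LIMSEQ_le_const2[OF itp_dist_cls] RJ(2) Su(2) J(1)) blast
      then show ?thesis
        using \<open>0 < e\<close> by simp
    qed
    moreover have "itp_partial_op X \<phi> T J u \<in> itp X \<phi>" if "finite J" for J
      using that by (simp add: RJ cls_itp)
    ultimately show "eventually (\<lambda>J. dist (itp_dist X \<phi> (itp_partial_op X \<phi> T J u) (?S u)) 0 < e) (finite_subsets_at_top UNIV)"
      unfolding eventually_finite_subsets_at_top
      by (intro exI[of _ "{..<M}"]) (auto simp: itp_dist_nonneg Su cls_itp)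
  qed
qed

end

end

section \<open>Almost invariant vectors and amenability\<close>

text \<open>Tychonoff: the sequence lives in a product of compact intervals, so it has a cluster
  point. Pulling the neighbourhoods of that point back to the indices yields one filter along which
  all coordinates converge together, so that identities between them survive in the limit.\<close>

lemma pointwise_cluster_filter:
  fixes m :: "nat \<Rightarrow> 'i \<Rightarrow> real"
  assumes bound: "\<And>n f. \<bar>m n f\<bar> \<le> c f"
  obtains M G where "G \<noteq> bot" "G \<le> sequentially" "\<And>f. ((\<lambda>n. m n f) \<longlongrightarrow> M f) G"
proof -
  define K where "K = PiE UNIV (\<lambda>f. {- c f..c f})"
  have "compactin (product_topology (\<lambda>_. euclidean) UNIV) K"
    unfolding K_def compactin_PiE by simp
  then have "compact K"
    by (simp add: euclidean_product_topology)
  have inK: "m n \<in> K" for n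
    unfolding K_def PiE_UNIV_domain using bound[of n] by (intro Pi_I) (simp add: abs_le_iff minus_le_iff)
  have "filtermap m sequentially \<noteq> bot"
    by (simp add: filtermap_bot_iff)
  moreover have "eventually (\<lambda>x. x \<in> K) (filtermap m sequentially)"
    using inK by (simp add: eventually_filtermap)
  ultimately obtain M where M: "inf (nhds M) (filtermap m sequentially) \<noteq> bot"
    using \<open>compact K\<close> unfolding compact_filter by blast
  define G where "G = inf sequentially (filtercomap m (nhds M))"
  have "G \<noteq> bot"
  proof
    \<comment> \<open>A trivial \<open>G\<close> would separate some neighbourhood of
      \<open>M\<close> from a tail of \<open>m\<close>, although \<open>M\<close> is a cluster
      point.\<close>
    assume "G = bot"
    then have "eventually (\<lambda>_. False) G"
      by simp
    then obtain P Q where P: "eventually P sequentially" and Q: "eventually Q (nhds M)"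
      and PQ: "\<And>n. P n \<Longrightarrow> Q (m n) \<Longrightarrow> False"
      unfolding G_def eventually_inf eventually_filtercomap by metis
    have "eventually (\<lambda>x. \<not> Q x) (filtermap m sequentially)"
      unfolding eventually_filtermap using P by (rule eventually_mono) (use PQ in blast)
    then have "eventually (\<lambda>_. False) (inf (nhds M) (filtermap m sequentially))"
      unfolding eventually_inf using Q by blast
    then show False
      using M by (simp add: trivial_limit_def)
  qed
  moreover have "((\<lambda>n. m n f) \<longlongrightarrow> M f) G" for f
  proof -
    have "filterlim m (nhds M) G"
      unfolding G_def by (rule filterlim_mono[OF filterlim_filtercomap order_refl]) simp
    moreover have "((\<lambda>x. x f) \<longlongrightarrow> M f) (nhds M)"
    proof (rule topological_tendstoI)
      fix S :: "real set" assume "open S" "M f \<in> S"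
      moreover have "open ((\<lambda>x. x f) -` S)"
        using \<open>open S\<close> continuous_on_product_coordinates by (rule open_vimage)
      ultimately show "eventually (\<lambda>x. x f \<in> S) (nhds M)"
        unfolding eventually_nhds by (intro exI[of _ "(\<lambda>x. x f) -` S"]) auto
    qed
    ultimately show ?thesis
      by (rule filterlim_compose[rotated])
  qed
  moreover have "G \<le> sequentially"
    by (simp add: G_def)
  ultimately show ?thesis
    using that by blast
qed

lemma ell_infty_bound:
  assumes "f \<in> ell_infty X"
  obtains c where "0 \<le> c" "\<And>x. \<bar>f x\<bar> \<le> c"
proof -
  obtain c where c: "\<And>x. x \<in> X \<Longrightarrow> \<bar>f x\<bar> \<le> c"
    using assms by (auto simp: ell_infty_def bounded_real)
  have "\<bar>f x\<bar> \<le> max c 0" for x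
    using assms c[of x] by (cases "x \<in> X") (auto simp: ell_infty_def)
  then show ?thesis
    using that[of "max c 0"] by simp
qed

lemma weighted_sum_summable:
  assumes "\<And>x. \<bar>f x\<bar> \<le> (c::real)" "u \<in> ell2 X"
  shows "(\<lambda>x. f x * (cmod (u x))\<^sup>2) summable_on X"
proof -
  have "(\<lambda>x. c * (cmod (u x))\<^sup>2) summable_on X"
    using assms(2) by (intro summable_on_cmult_right) (simp add: ell2_def)
  then have "(\<lambda>x. norm (f x * (cmod (u x))\<^sup>2)) summable_on X"
    by (rule summable_on_comparison_test) (auto simp: abs_mult assms(1) mult_right_mono)
  then show ?thesis
    by (rule abs_summable_summable)
qed

text \<open>The quantity \<open>r\<close> may exceed the distance, so that \<open>u = v\<close> is no special case for the weighted
  AM-GM inequality behind this bound.\<close>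

lemma weighted_sum_diff_le:
  assumes f: "\<And>x. \<bar>f x\<bar> \<le> (c::real)" and u: "u \<in> ell2 X" "ell2_norm X u = 1"
    and v: "v \<in> ell2 X" "ell2_norm X v = 1"
    and r: "0 < r" "ell2_norm X (\<lambda>x. u x - v x) \<le> r"
  shows "\<bar>(\<Sum>\<^sub>\<infinity>x\<in>X. f x * (cmod (u x))\<^sup>2) - (\<Sum>\<^sub>\<infinity>x\<in>X. f x * (cmod (v x))\<^sup>2)\<bar> \<le> c * (5 / 2 * r)"
proof -
  let ?S = "(\<Sum>\<^sub>\<infinity>x\<in>X. f x * (cmod (u x))\<^sup>2) + - (\<Sum>\<^sub>\<infinity>x\<in>X. f x * (cmod (v x))\<^sup>2)"
  let ?g = "\<lambda>x. f x * (cmod (u x))\<^sup>2 + - (f x * (cmod (v x))\<^sup>2)"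
  let ?k = "\<lambda>x. c * (1 / (2 * r) * (cmod (u x - v x))\<^sup>2 + r * ((cmod (u x))\<^sup>2 + (cmod (v x))\<^sup>2))"
  let ?D = "ell2_norm X (\<lambda>x. u x - v x)"
  have "0 \<le> c"
    using f[of undefined] by linarith
  have g: "(?g has_sum ?S) X"
    by (intro has_sum_add has_sum_uminus[THEN iffD2] has_sum_infsum weighted_sum_summable[OF f] u v)
      (simp add: has_sum_infsum weighted_sum_summable[OF f] u v)
  have k: "(?k has_sum c * (1 / (2 * r) * ?D\<^sup>2 + r * (1\<^sup>2 + 1\<^sup>2))) X"
    using has_sum_ell2_norm[OF u(1)] has_sum_ell2_norm[OF v(1)] unfolding u v
    by (intro has_sum_cmult_right has_sum_add has_sum_ell2_norm ell2_diff u v)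
  have pointwise: "\<bar>?g x\<bar> \<le> ?k x" for x
  proof -
    define a b e where "a = cmod (u x)" and "b = cmod (v x)" and "e = cmod (u x - v x)"
    have ab: "0 \<le> a" "0 \<le> b" "\<bar>a - b\<bar> \<le> e"
      unfolding a_def b_def e_def by (auto simp: norm_triangle_ineq3)
    have "\<bar>a\<^sup>2 - b\<^sup>2\<bar> = \<bar>a - b\<bar> * (a + b)"
      using ab by (simp add: power2_eq_square square_diff_square_factored abs_mult mult.commute)
    also have "\<dots> \<le> e * (a + b)"
      using ab by (intro mult_right_mono) auto
    also have "\<dots> \<le> 1 / (2 * r) * e\<^sup>2 + r * (a\<^sup>2 + b\<^sup>2)"
    proof -
      \<comment> \<open>The second square replaces \<open>(a + b)\<^sup>2\<close> by
        \<open>2 * (a\<^sup>2 + b\<^sup>2)\<close>, whose sum over \<open>X\<close> is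
        known.\<close>
      have "0 \<le> (e - r * (a + b))\<^sup>2 + r\<^sup>2 * (a - b)\<^sup>2"
        by simp
      then have "2 * r * (e * (a + b)) \<le> e\<^sup>2 + 2 * r\<^sup>2 * (a\<^sup>2 + b\<^sup>2)"
        by (simp add: power2_eq_square algebra_simps)
      then show ?thesis
        using r(1) by (simp add: field_simps power2_eq_square)
    qed
    finally have le: "\<bar>a\<^sup>2 - b\<^sup>2\<bar> \<le> 1 / (2 * r) * e\<^sup>2 + r * (a\<^sup>2 + b\<^sup>2)" .
    have "\<bar>?g x\<bar> = \<bar>f x\<bar> * \<bar>a\<^sup>2 - b\<^sup>2\<bar>"
      by (simp add: a_def b_def abs_mult[symmetric] right_diff_distrib)
    also have "\<dots> \<le> c * (1 / (2 * r) * e\<^sup>2 + r * (a\<^sup>2 + b\<^sup>2))"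
      using f le \<open>0 \<le> c\<close> by (intro mult_mono) auto
    finally show ?thesis
      by (simp only: a_def b_def e_def)
  qed
  have "?S \<le> c * (1 / (2 * r) * ?D\<^sup>2 + r * (1\<^sup>2 + 1\<^sup>2))"
    by (rule has_sum_mono[OF g k]) (use pointwise abs_le_D1 in blast)
  moreover have "- ?S \<le> c * (1 / (2 * r) * ?D\<^sup>2 + r * (1\<^sup>2 + 1\<^sup>2))"
    by (rule has_sum_mono[OF has_sum_uminus[THEN iffD2] k]) (use g pointwise abs_le_D2 in auto)
  \<comment> \<open>Since \<open>?D \<le> r\<close>, the left side is at most
    \<open>r / 2 + 2 * r\<close>; this is the origin of 5/2.\<close>
  moreover have "1 / (2 * r) * ?D\<^sup>2 + r * (1\<^sup>2 + 1\<^sup>2) \<le> 5 / 2 * r"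
  proof -
    have "?D\<^sup>2 \<le> r\<^sup>2"
      using r ell2_norm_nonneg by (intro power_mono) auto
    then have "1 / (2 * r) * ?D\<^sup>2 \<le> 1 / (2 * r) * r\<^sup>2"
      using r(1) by (intro mult_left_mono) auto
    then show ?thesis
      using r(1) by (simp add: power2_eq_square)
  qed
  then have "c * (1 / (2 * r) * ?D\<^sup>2 + r * (1\<^sup>2 + 1\<^sup>2)) \<le> c * (5 / 2 * r)"
    using \<open>0 \<le> c\<close> by (rule mult_left_mono)
  ultimately show ?thesis
    by linarith
qed

context group
begin

lemma translate_bij: "b \<in> carrier G \<Longrightarrow> bij_betw (\<lambda>x. inv b \<otimes> x) (carrier G) (carrier G)"
  by (rule bij_betw_byWitness[where f' = "\<lambda>x. b \<otimes> x"]) (auto simp: m_assoc[symmetric])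

lemma left_translate_ell2:
  assumes "b \<in> carrier G" "f \<in> ell2 (carrier G)"
  shows "left_translate G b f \<in> ell2 (carrier G)"
    "ell2_norm (carrier G) (left_translate G b f) = ell2_norm (carrier G) f"
  using ell2_reindex[OF translate_bij[OF assms(1)], of "\<lambda>_. 1" f] assms(2)
  unfolding left_translate_def mult_1_left by simp_all

lemma left_translate_ell_infty:
  assumes "f \<in> ell_infty (carrier G)"
  shows "left_translate G b f \<in> ell_infty (carrier G)"
proof -
  obtain c where "\<And>x. \<bar>f x\<bar> \<le> c"
    using ell_infty_bound[OF assms] by blast
  then show ?thesis
    by (auto simp: ell_infty_def left_translate_def bounded_real)
qed

text \<open>Substituting \<open>b \<otimes> x\<close> for \<open>x\<close> shifts the translation
  from \<open>f\<close> to the vector, where it becomes the one by \<open>inv b\<close>.\<close>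

lemma infsum_left_translate:
  fixes f :: "'a \<Rightarrow> real"
  assumes "b \<in> carrier G"
  shows "(\<Sum>\<^sub>\<infinity>x\<in>carrier G. left_translate G b f x * (cmod (u x))\<^sup>2)
    = (\<Sum>\<^sub>\<infinity>x\<in>carrier G. f x * (cmod (left_translate G (inv b) u x))\<^sup>2)"
  by (rule infsum_reindex_bij_witness[where i = "\<lambda>x. b \<otimes> x" and j = "\<lambda>x. inv b \<otimes> x"])
    (use assms in \<open>auto simp: left_translate_def m_assoc[symmetric]\<close>)

theorem almost_invariant_imp_amenable:
  assumes unit: "\<And>i. \<phi> i \<in> ell2 (carrier G)" "\<And>i. ell2_norm (carrier G) (\<phi> i) = 1"
    and inv: "\<And>b. b \<in> carrier G \<Longrightarrow>
      (\<lambda>i. ell2_norm (carrier G) (\<lambda>x. left_translate G b (\<phi> i) x - \<phi> i x)) \<longlonglongrightarrow> 0"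
  shows "amenable G"
proof -
  let ?X = "carrier G"
  \<comment> \<open>The value 0 outside \<open>ell_infty\<close> provides a bound for every
    \<open>f\<close>, as \<open>pointwise_cluster_filter\<close> demands.\<close>
  define m where "m i f = (if f \<in> ell_infty ?X then \<Sum>\<^sub>\<infinity>x\<in>?X. f x * (cmod (\<phi> i x))\<^sup>2 else 0)" for i f
  have sum: "(\<lambda>x. f x * (cmod (\<phi> i x))\<^sup>2) summable_on ?X" if "f \<in> ell_infty ?X" for f i
    by (rule ell_infty_bound[OF that]) (rule weighted_sum_summable[OF _ unit(1)])
  have norm1: "((\<lambda>x. (cmod (\<phi> i x))\<^sup>2) has_sum 1) ?X" for i
    using has_sum_ell2_norm[OF unit(1)[of i]] by (simp add: unit)
  have "\<exists>c. \<forall>i. \<bar>m i f\<bar> \<le> c" for f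
  proof (cases "f \<in> ell_infty ?X")
    case True
    obtain c where c: "0 \<le> c" "\<And>x. \<bar>f x\<bar> \<le> c"
      using ell_infty_bound[OF True] by metis
    have "\<bar>m i f\<bar> \<le> c" for i
    proof -
      have bd: "((\<lambda>x. c * (cmod (\<phi> i x))\<^sup>2) has_sum c * 1) ?X" "((\<lambda>x. (- c) * (cmod (\<phi> i x))\<^sup>2) has_sum (- c) * 1) ?X"
        by (intro has_sum_cmult_right norm1)+
      have h: "((\<lambda>x. f x * (cmod (\<phi> i x))\<^sup>2) has_sum m i f) ?X"
        using True sum[OF True] by (simp add: m_def)
      have fc: "f x \<le> c" "- c \<le> f x" for x
        using c(2)[of x] by linarith+
      have "m i f \<le> c * 1"
        by (rule has_sum_mono[OF h bd(1)]) (simp add: mult_right_mono fc)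
      moreover have "(- c) * 1 \<le> m i f"
        by (rule has_sum_mono[OF bd(2) h]) (intro mult_right_mono fc zero_le_power2)
      ultimately show ?thesis by simp
    qed
    then show ?thesis by blast
  qed (auto simp: m_def)
  then obtain c where c: "\<And>i f. \<bar>m i f\<bar> \<le> c f"
    by metis
  obtain M F where F: "F \<noteq> bot" "F \<le> sequentially" and M: "\<And>f. ((\<lambda>i. m i f) \<longlongrightarrow> M f) F"
    using pointwise_cluster_filter[of m c, OF c] by metis
  show ?thesis
    unfolding amenable_def
  proof (intro exI[of _ M] conjI ballI allI impI)
    fix f g assume f: "f \<in> ell_infty ?X" and g: "g \<in> ell_infty ?X"
    obtain c d where cd: "\<And>x. \<bar>f x\<bar> \<le> c" "\<And>x. \<bar>g x\<bar> \<le> d"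
      using ell_infty_bound[OF f] ell_infty_bound[OF g] by metis
    have "\<bar>f x + g x\<bar> \<le> c + d" for x
      using cd[of x] by linarith
    then have fg: "(\<lambda>x. f x + g x) \<in> ell_infty ?X"
      using f g by (auto simp: ell_infty_def bounded_real)
    have "m i (\<lambda>x. f x + g x) = m i f + m i g" for i
      using f g fg sum by (simp add: m_def distrib_right infsum_add)
    then have "((\<lambda>i. m i (\<lambda>x. f x + g x)) \<longlongrightarrow> M f + M g) F"
      using tendsto_add[OF M[of f] M[of g]] by simp
    then show "M (\<lambda>x. f x + g x) = M f + M g"
      using tendsto_unique[OF F(1) M] by blast
  next
    fix c f assume f: "f \<in> ell_infty ?X"
    obtain d where d: "\<And>x. \<bar>f x\<bar> \<le> d"
      using ell_infty_bound[OF f] by metis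
    then have "\<bar>c * f x\<bar> \<le> \<bar>c\<bar> * d" for x
      by (simp add: abs_mult mult_left_mono)
    then have cf: "(\<lambda>x. c * f x) \<in> ell_infty ?X"
      using f by (auto simp: ell_infty_def bounded_real)
    have "m i (\<lambda>x. c * f x) = c * m i f" for i
      using f cf sum[OF f] by (simp add: m_def mult.assoc infsum_cmult_right)
    then have "((\<lambda>i. m i (\<lambda>x. c * f x)) \<longlongrightarrow> c * M f) F"
      using tendsto_mult_left[OF M[of f]] by simp
    then show "M (\<lambda>x. c * f x) = c * M f"
      using tendsto_unique[OF F(1) M] by blast
  next
    fix f :: "'a \<Rightarrow> real" assume "f \<in> ell_infty ?X" and "\<forall>x. 0 \<le> f x"
    then have "0 \<le> m i f" for i
      by (simp add: m_def infsum_nonneg)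
    then show "0 \<le> M f"
      by (intro tendsto_lowerbound[OF M _ F(1)]) simp
  next
    have ind: "indicator ?X \<in> ell_infty ?X"
      by (auto simp: ell_infty_def bounded_real intro!: exI[of _ 1])
    have "(\<Sum>\<^sub>\<infinity>x\<in>?X. indicator ?X x * (cmod (\<phi> i x))\<^sup>2) = (\<Sum>\<^sub>\<infinity>x\<in>?X. (cmod (\<phi> i x))\<^sup>2)" for i
      by (rule infsum_cong) simp
    then have "m i (indicator ?X) = 1" for i
      using ind infsumI[OF norm1] by (simp add: m_def)
    then show "M (indicator ?X) = 1"
      using M[of "indicator ?X"] F(1) by (simp add: tendsto_const_iff)
  next
    fix b and f :: "'a \<Rightarrow> real" assume b: "b \<in> ?X" and f: "f \<in> ell_infty ?X"
    obtain c where c: "0 \<le> c" "\<And>x. \<bar>f x\<bar> \<le> c"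
      using ell_infty_bound[OF f] by metis
    let ?D = "\<lambda>i. ell2_norm ?X (\<lambda>x. left_translate G (inv b) (\<phi> i) x - \<phi> i x)"
    \<comment> \<open>The extra summand keeps \<open>r i\<close> positive even when
      \<open>?D i\<close> is 0, and it still tends to 0.\<close>
    define r where "r i = ?D i + inverse (real (Suc i))" for i
    have r: "0 < r i" "?D i \<le> r i" for i
      by (simp_all add: r_def add_nonneg_pos ell2_norm_nonneg)
    have "r \<longlonglongrightarrow> 0"
      unfolding r_def using tendsto_add[OF inv[of "inv b"] LIMSEQ_inverse_real_of_nat] b by simp
    then have lim: "(\<lambda>i. c * (5 / 2 * r i)) \<longlonglongrightarrow> 0"
      by (intro tendsto_mult_right_zero)
    have "\<bar>m i (left_translate G b f) - m i f\<bar> \<le> c * (5 / 2 * r i)" for i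
      using weighted_sum_diff_le[OF c(2) _ _ unit(1) unit(2) r(1) r(2)] b
      by (simp add: m_def f left_translate_ell_infty infsum_left_translate left_translate_ell2 unit)
    then have "(\<lambda>i. m i (left_translate G b f) - m i f) \<longlonglongrightarrow> 0"
      by (intro Lim_null_comparison[OF always_eventually lim]) simp
    then have "((\<lambda>i. m i (left_translate G b f) - m i f) \<longlongrightarrow> 0) F"
      by (rule tendsto_mono[OF F(2)])
    then have "M (left_translate G b f) - M f = 0"
      by (rule tendsto_unique[OF F(1) tendsto_diff[OF M M]])
    then show "M (left_translate G b f) = M f" by simp
  qed
qed

text \<open>If \<open>b\<close> were no quotient of two points of one support, each
  \<open>\<phi> i\<close> and its translate by \<open>b\<close> would have disjoint supports; all
  coefficients would vanish and could not tend to 1. Supports of l2 vectors are countable.\<close>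

lemma almost_invariant_imp_countable:
  assumes unit: "\<And>i. \<phi> i \<in> ell2 (carrier G)"
    and coef: "\<And>b. b \<in> carrier G \<Longrightarrow>
      (\<lambda>i. Re (\<Sum>\<^sub>\<infinity>x\<in>carrier G. left_translate G b (\<phi> i) x * cnj (\<phi> i x))) \<longlonglongrightarrow> 1"
  shows "countable (carrier G)"
proof -
  define S where "S i = {x \<in> carrier G. \<phi> i x \<noteq> 0}" for i
  have S: "countable (S i)" for i
  proof -
    have "(\<lambda>x. (cmod (\<phi> i x))\<^sup>2) summable_on carrier G"
      using unit by (simp add: ell2_def)
    from summable_countable_real[OF this] show ?thesis
      by (simp add: S_def)
  qed
  have "carrier G \<subseteq> (\<Union>i. (\<lambda>(x, y). x \<otimes> inv y) ` (S i \<times> S i))"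
  proof
    fix b assume b: "b \<in> carrier G"
    show "b \<in> (\<Union>i. (\<lambda>(x, y). x \<otimes> inv y) ` (S i \<times> S i))"
    proof (rule ccontr)
      assume not: "\<not> ?thesis"
      have "left_translate G b (\<phi> i) x * cnj (\<phi> i x) = 0" if x: "x \<in> carrier G" for i x
      proof (rule ccontr)
        assume "left_translate G b (\<phi> i) x * cnj (\<phi> i x) \<noteq> 0"
        then have "(x, inv b \<otimes> x) \<in> S i \<times> S i"
          using x b by (auto simp: S_def left_translate_def)
        moreover have "b = x \<otimes> inv (inv b \<otimes> x)"
          using x b by (simp add: inv_mult_group m_assoc[symmetric])
        ultimately have "b \<in> (\<lambda>(x, y). x \<otimes> inv y) ` (S i \<times> S i)"
          by (metis (mono_tags, lifting) case_prod_conv image_eqI)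
        then show False
          using not by blast
      qed
      then have "(\<Sum>\<^sub>\<infinity>x\<in>carrier G. left_translate G b (\<phi> i) x * cnj (\<phi> i x)) = 0" for i
        by (intro infsum_0)
      then show False
        using coef[OF b] by (simp add: LIMSEQ_const_iff)
    qed
  qed
  moreover have "countable (\<Union>i. (\<lambda>(x, y). x \<otimes> inv y) ` (S i \<times> S i))"
    using S by blast
  ultimately show ?thesis
    by (rule countable_subset)
qed

end

section \<open>The representations attached to bilinear maps\<close>

lemma normalized_indicator_unit:
  assumes "finite F" "F \<noteq> {}" "F \<subseteq> X"
  shows "normalized_indicator F \<in> ell2 X" "ell2_norm X (normalized_indicator F) = 1"
proof -
  have "0 < card F"
    using assms by (simp add: card_gt_0_iff)
  have "((\<lambda>x. (cmod (normalized_indicator F x))\<^sup>2) has_sum 1\<^sup>2) F"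
    using assms(1,2) \<open>0 < card F\<close>
    by (intro has_sum_finiteI) (simp_all add: normalized_indicator_def norm_divide power_divide)
  then have h: "((\<lambda>x. (cmod (normalized_indicator F x))\<^sup>2) has_sum 1\<^sup>2) X"
    by (rule has_sum_cong_neutral[THEN iffD1, rotated -1]) (use assms in \<open>auto simp: normalized_indicator_def\<close>)
  then show "normalized_indicator F \<in> ell2 X"
    using assms(3) by (auto simp: ell2_def normalized_indicator_def has_sum_imp_summable indicator_def)
  show "ell2_norm X (normalized_indicator F) = 1"
    by (rule ell2_norm_eqI[OF h]) simp
qed

lemma U_op_eq_T:
  "U_op B \<tau> (a, b) = (\<lambda>f x. if x \<in> carrier B then \<tau> a x * f (inv\<^bsub>B\<^esub> b \<otimes>\<^bsub>B\<^esub> x) else 0)"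
  by (auto simp: U_op_def V_op_def left_translate_def fun_eq_iff)

lemma bilinear_circle_norm:
  "bilinear_circle A B \<tau> \<Longrightarrow> a \<in> carrier A \<Longrightarrow> b \<in> carrier B \<Longrightarrow> cmod (\<tau> a b) = 1"
  by (auto simp: bilinear_circle_def hom_def circle_group_def Pi_iff)

text \<open>The only idempotent of the circle is 1. Hence the operators at
  \<open>(\<one>, b)\<close> are pure translations, which is how the regular representation of
  \<open>B\<close> enters.\<close>

lemma bilinear_circle_one:
  assumes "group A" "bilinear_circle A B \<tau>" "b \<in> carrier B"
  shows "\<tau> \<one>\<^bsub>A\<^esub> b = 1"
proof -
  interpret A: group A by fact
  have "(\<lambda>a. \<tau> a b) \<in> hom A circle_group"
    using assms(2,3) by (simp add: bilinear_circle_def)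
  from hom_mult[OF this A.one_closed A.one_closed] have "\<tau> \<one>\<^bsub>A\<^esub> b = \<tau> \<one>\<^bsub>A\<^esub> b * \<tau> \<one>\<^bsub>A\<^esub> b"
    by (simp add: circle_group_def)
  moreover have "\<tau> \<one>\<^bsub>A\<^esub> b \<noteq> 0"
    using bilinear_circle_norm[OF assms(2) A.one_closed assms(3)] by auto
  ultimately show ?thesis by simp
qed

text \<open>\<open>itp_op_exists\<close> depends on its operators as HOL functions on all arguments,
  so the link is an equality of functions and not merely agreement on l2.\<close>

lemma monomial_unitaries_U_op:
  assumes "group B" "\<And>i. bilinear_circle A B (\<sigma> i)" "a \<in> carrier A" "b \<in> carrier B"
    and "\<And>i. \<phi> i \<in> ell2 (carrier B)" "\<And>i. ell2_norm (carrier B) (\<phi> i) = 1"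
  shows "monomial_unitaries (carrier B) \<phi> (\<lambda>i. \<sigma> i a) (\<lambda>_ x. inv\<^bsub>B\<^esub> b \<otimes>\<^bsub>B\<^esub> x)"
    and "monomial_unitaries.T (carrier B) (\<lambda>i. \<sigma> i a) (\<lambda>_ x. inv\<^bsub>B\<^esub> b \<otimes>\<^bsub>B\<^esub> x) = (\<lambda>i. U_op B (\<sigma> i) (a, b))"
proof -
  show *: "monomial_unitaries (carrier B) \<phi> (\<lambda>i. \<sigma> i a) (\<lambda>_ x. inv\<^bsub>B\<^esub> b \<otimes>\<^bsub>B\<^esub> x)"
    using assms by unfold_locales (auto intro: bilinear_circle_norm group.translate_bij)
  show "monomial_unitaries.T (carrier B) (\<lambda>i. \<sigma> i a) (\<lambda>_ x. inv\<^bsub>B\<^esub> b \<otimes>\<^bsub>B\<^esub> x) = (\<lambda>i. U_op B (\<sigma> i) (a, b))"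
    by (intro ext) (simp add: monomial_unitaries.T_def[OF *] U_op_eq_T)
qed

text \<open>The summand lives on the intersection \<open>?E\<close> of \<open>F\<close> with its
  translate and equals \<open>\<tau> a x / card F\<close> there. So the defect splits into the
  proportion of \<open>F\<close> lost by translating and the sum of \<open>1 - \<tau> a x\<close>
  over \<open>?E\<close>, divided by \<open>card F\<close>.\<close>

lemma one_minus_coef_le:
  fixes B :: "('b, 'n) monoid_scheme"
  assumes "group B" "finite F" "F \<noteq> {}" "F \<subseteq> carrier B" "b \<in> carrier B"
  defines "\<phi> \<equiv> normalized_indicator F"
  shows "cmod (1 - (\<Sum>\<^sub>\<infinity>x\<in>carrier B. U_op B \<tau> (a, b) \<phi> x * cnj (\<phi> x)))
    \<le> \<bar>1 - real (card (F \<inter> (b <#\<^bsub>B\<^esub> F))) / real (card F)\<bar>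
      + 1 / real (card F) * (\<Sum>x\<in>F. cmod (1 - \<tau> a x))"
proof -
  interpret B: group B by fact
  let ?E = "F \<inter> (b <#\<^bsub>B\<^esub> F)" and ?n = "card F"
  have n: "0 < ?n"
    using assms(2,3) by (simp add: card_gt_0_iff)
  have mem: "x \<in> b <#\<^bsub>B\<^esub> F \<longleftrightarrow> inv\<^bsub>B\<^esub> b \<otimes>\<^bsub>B\<^esub> x \<in> F" if "x \<in> carrier B" for x
  proof
    assume "x \<in> b <#\<^bsub>B\<^esub> F"
    then show "inv\<^bsub>B\<^esub> b \<otimes>\<^bsub>B\<^esub> x \<in> F"
      using assms(4,5) by (auto simp: l_coset_def B.m_assoc[symmetric] subset_iff)
  next
    assume "inv\<^bsub>B\<^esub> b \<otimes>\<^bsub>B\<^esub> x \<in> F"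
    moreover have "x = b \<otimes>\<^bsub>B\<^esub> (inv\<^bsub>B\<^esub> b \<otimes>\<^bsub>B\<^esub> x)"
      using assms(5) that by (simp add: B.m_assoc[symmetric])
    ultimately show "x \<in> b <#\<^bsub>B\<^esub> F"
      unfolding l_coset_def by blast
  qed
  have sqrt: "complex_of_real (sqrt (real ?n)) * complex_of_real (sqrt (real ?n)) = of_nat ?n"
    by (simp flip: of_real_mult)
  have "(\<Sum>\<^sub>\<infinity>x\<in>carrier B. U_op B \<tau> (a, b) \<phi> x * cnj (\<phi> x)) = (\<Sum>\<^sub>\<infinity>x\<in>?E. \<tau> a x / of_nat ?n)"
    by (rule infsum_cong_neutral)
      (use assms(4) in \<open>auto simp: U_op_eq_T \<phi>_def normalized_indicator_def mem subset_iff sqrt\<close>)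
  also have "\<dots> = (\<Sum>x\<in>?E. \<tau> a x) / of_nat ?n"
    using assms(2) by (simp add: sum_divide_distrib)
  finally have coef: "(\<Sum>\<^sub>\<infinity>x\<in>carrier B. U_op B \<tau> (a, b) \<phi> x * cnj (\<phi> x)) = (\<Sum>x\<in>?E. \<tau> a x) / of_nat ?n" .
  have "1 - (\<Sum>x\<in>?E. \<tau> a x) / of_nat ?n
      = of_real (1 - real (card ?E) / real ?n) + (\<Sum>x\<in>?E. 1 - \<tau> a x) / of_nat ?n"
    using n by (simp add: sum_subtractf diff_divide_distrib)
  also have "cmod \<dots> \<le> \<bar>1 - real (card ?E) / real ?n\<bar> + cmod ((\<Sum>x\<in>?E. 1 - \<tau> a x) / of_nat ?n)"
    by (rule norm_triangle_le) (simp only: norm_of_real order_refl)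
  also have "cmod ((\<Sum>x\<in>?E. 1 - \<tau> a x) / of_nat ?n) = 1 / real ?n * cmod (\<Sum>x\<in>?E. 1 - \<tau> a x)"
    by (simp add: norm_divide)
  \<comment> \<open>Passing from \<open>?E\<close> to \<open>F\<close> only adds nonnegative terms
    and matches the series assumed for \<open>\<sigma>\<close>.\<close>
  also have "\<dots> \<le> 1 / real ?n * (\<Sum>x\<in>F. cmod (1 - \<tau> a x))"
    using assms(2) by (intro mult_left_mono order_trans[OF norm_sum] sum_mono2) auto
  finally show ?thesis
    by (simp add: coef)
qed

theorem theorem3p6:
  fixes A :: "('a, 'm) monoid_scheme" and B :: "('b, 'n) monoid_scheme"
    and \<sigma> :: "nat \<Rightarrow> 'a \<Rightarrow> 'b \<Rightarrow> complex"
  assumes "group A" and "group B" and "\<not> trivial_group (A \<times>\<times> B)"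
    and "\<And>i. bilinear_circle A B (\<sigma> i)"
  shows "((\<exists>\<phi> :: nat \<Rightarrow> 'b \<Rightarrow> complex.
             (\<forall>i. \<phi> i \<in> ell2 (carrier B) \<and> ell2_norm (carrier B) (\<phi> i) = 1) \<and>
             itp_rep_exists (A \<times>\<times> B) (carrier B) \<phi> (\<lambda>i. U_op B (\<sigma> i)))
           \<longrightarrow> countable (carrier B) \<and> amenable B)
       \<and> (\<forall>F :: nat \<Rightarrow> 'b set.
             countable (carrier B) \<and> amenable B \<and> sigmaF_sequence B F \<and>
             (\<forall>a\<in>carrier A.
                summable (\<lambda>i. 1 / real (card (F i)) * (\<Sum>b\<in>F i. cmod (1 - \<sigma> i a b))))
           \<longrightarrow> itp_rep_exists (A \<times>\<times> B) (carrier B) (\<lambda>i. normalized_indicator (F i))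
                 (\<lambda>i. U_op B (\<sigma> i)))"
proof (intro conjI impI allI; (elim exE conjE)?)
  interpret A: group A by fact
  interpret B: group B by fact
  fix \<phi> :: "nat \<Rightarrow> 'b \<Rightarrow> complex"
  assume "\<forall>i. \<phi> i \<in> ell2 (carrier B) \<and> ell2_norm (carrier B) (\<phi> i) = 1"
  then have unit: "\<And>i. \<phi> i \<in> ell2 (carrier B)" "\<And>i. ell2_norm (carrier B) (\<phi> i) = 1"
    by auto
  assume ex: "itp_rep_exists (A \<times>\<times> B) (carrier B) \<phi> (\<lambda>i. U_op B (\<sigma> i))"
  \<comment> \<open>Restricting to the elements \<open>(\<one>, b)\<close> removes the bilinear maps
    and leaves translations.\<close>
  have U: "U_op B (\<sigma> i) (\<one>\<^bsub>A\<^esub>, b) = left_translate B b" for i b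
    using bilinear_circle_one[OF assms(1,4)] by (intro ext) (auto simp: U_op_eq_T left_translate_def)
  have lim: "(\<lambda>i. Re (\<Sum>\<^sub>\<infinity>x\<in>carrier B. left_translate B b (\<phi> i) x * cnj (\<phi> i x))) \<longlonglongrightarrow> 1"
    "(\<lambda>i. ell2_norm (carrier B) (\<lambda>x. left_translate B b (\<phi> i) x - \<phi> i x)) \<longlonglongrightarrow> 0"
    if b: "b \<in> carrier B" for b
  proof -
    note mono = monomial_unitaries_U_op[OF assms(2,4) A.one_closed b unit]
    interpret monomial_unitaries "carrier B" \<phi> "\<lambda>i. \<sigma> i \<one>\<^bsub>A\<^esub>" "\<lambda>_ x. inv\<^bsub>B\<^esub> b \<otimes>\<^bsub>B\<^esub> x"
      by (rule mono(1))
    have T: "T i = left_translate B b" for i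
      by (simp add: mono(2) U)
    have "itp_op_exists (carrier B) \<phi> T"
      using ex b unfolding mono(2) by (auto simp: itp_rep_exists_def)
    then have lim: "(\<lambda>i. Re (coef i)) \<longlonglongrightarrow> 1"
      by (rule itp_op_exists_imp_coef)
    then show "(\<lambda>i. Re (\<Sum>\<^sub>\<infinity>x\<in>carrier B. left_translate B b (\<phi> i) x * cnj (\<phi> i x))) \<longlonglongrightarrow> 1"
      by (simp add: coef_def T)
    \<comment> \<open>Coefficients tending to 1 make the vectors almost invariant, since the squared
      displacement is \<open>2 * (1 - Re (coef i))\<close>.\<close>
    have "(\<lambda>i. sqrt (2 * (1 - Re (coef i)))) \<longlonglongrightarrow> sqrt (2 * (1 - 1))"
      by (intro tendsto_intros lim)
    moreover have "sqrt (2 * (1 - Re (coef i))) = ell2_norm (carrier B) (\<lambda>x. left_translate B b (\<phi> i) x - \<phi> i x)" for i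
      unfolding T_unit_dist_sq[symmetric] T by (simp add: ell2_norm_nonneg)
    ultimately show "(\<lambda>i. ell2_norm (carrier B) (\<lambda>x. left_translate B b (\<phi> i) x - \<phi> i x)) \<longlonglongrightarrow> 0"
      by simp
  qed
  show "countable (carrier B)"
    by (rule B.almost_invariant_imp_countable[OF unit(1) lim(1)])
  show "amenable B"
    by (rule B.almost_invariant_imp_amenable[OF unit lim(2)])
next
  fix F :: "nat \<Rightarrow> 'b set"
  assume F: "sigmaF_sequence B F"
    and \<sigma>: "\<forall>a\<in>carrier A. summable (\<lambda>i. 1 / real (card (F i)) * (\<Sum>b\<in>F i. cmod (1 - \<sigma> i a b)))"
  let ?\<phi> = "\<lambda>i. normalized_indicator (F i)"
  have Fi: "finite (F i)" "F i \<noteq> {}" "F i \<subseteq> carrier B" for i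
    using F by (auto simp: sigmaF_sequence_def)
  note unit = normalized_indicator_unit[OF Fi]
  show "itp_rep_exists (A \<times>\<times> B) (carrier B) ?\<phi> (\<lambda>i. U_op B (\<sigma> i))"
    unfolding itp_rep_exists_def
  proof
    fix x assume "x \<in> carrier (A \<times>\<times> B)"
    then obtain a b where x: "x = (a, b)" and a: "a \<in> carrier A" and b: "b \<in> carrier B"
      by (auto simp: DirProd_def)
    note mono = monomial_unitaries_U_op[OF assms(2,4) a b unit]
    interpret monomial_unitaries "carrier B" ?\<phi> "\<lambda>i. \<sigma> i a" "\<lambda>_ x. inv\<^bsub>B\<^esub> b \<otimes>\<^bsub>B\<^esub> x"
      by (rule mono(1))
    \<comment> \<open>The first summand is the Foelner defect at \<open>b\<close>, the second the
      averaged defect of \<open>\<sigma> i\<close> at \<open>a\<close>; together they dominate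
      \<open>cmod (1 - coef i)\<close>.\<close>
    have "summable (\<lambda>i. \<bar>1 - real (card (F i \<inter> (b <#\<^bsub>B\<^esub> F i))) / real (card (F i))\<bar>
        + 1 / real (card (F i)) * (\<Sum>b\<in>F i. cmod (1 - \<sigma> i a b)))"
      using F \<sigma> a b by (intro summable_add) (auto simp: sigmaF_sequence_def)
    then have "summable (\<lambda>i. cmod (1 - coef i))"
      by (rule summable_comparison_test'[where N = 0])
        (use one_minus_coef_le[OF assms(2) Fi b] in \<open>simp add: coef_def mono(2)\<close>)
    then show "itp_op_exists (carrier B) ?\<phi> (\<lambda>i. U_op B (\<sigma> i) x)"
      using summable_imp_itp_op_exists unfolding mono(2) x by simp
  qed
qed

end
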